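(* Let $(L,\Delta,\varphi_L,\alpha,R)$ be a Rota-Baxter Hom-CoAss CoDer pair of weight $\lambda=0$, where $R\circ\alpha=\alpha\circ R$ and $\varphi_L\circ R=R\circ\varphi_L$. Define $\tilde\Delta:L\to L\otimes L$ by $$\tilde\Delta=(R\otimes 1_L)\circ\Delta-\tau\circ(1_L\otimes R)\circ\Delta,$$ i.e. $\tilde\Delta(l)=R(l_1)\otimes l_2-R(l_2)\otimes l_1$ for $\Delta(l)=l_1\otimes l_2$ (Sweedler notation). Then $(L,\tilde\Delta,\varphi_L,\alpha)$ is a Hom-pre-Lie CoDer pair.
   Context: All vector spaces and tensor products are over a field $\mathbb{K}$ of characteristic $0$. Let $\tau(x\otimes y)=y\otimes x$ and $\tau^{12}(x\otimes y\otimes z)=y\otimes x\otimes z$. Sweedler notation $\Delta(l)=l_1\otimes l_2$ (summation suppressed) is used. A Hom-CoAss CoDer pair $(L,\Delta,\varphi_L,\alpha)$ is a vector space $L$ with linear maps $\Delta:L\to L\otimes L$, $\alpha:L\to L$, $\varphi_L:L\to L$ such that $(\alpha\otimes\Delta)\circ\Delta=(\Delta\otimes\alpha)\circ\Delta$ (Hom-coassociativity) and $\Delta\circ\varphi_L=(\varphi_L\otimes\alpha)\circ\Delta+(\alpha\otimes\varphi_L)\circ\Delta$. It is a Rota-Baxter Hom-CoAss CoDer pair of weight $\lambda\in\mathbb{K}$ if moreover there is given a linear map $R:L\to L$ with $R\circ\alpha=\alpha\circ R$, $\varphi_L\circ R=R\circ\varphi_L$, and for all $l\in L$ $$R(l_1)\otimes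 R(l_2)=R(l)_1\otimes R(R(l)_2)+R(R(l)_1)\otimes R(l)_2+\lambda\,R(l)_1\otimes R(l)_2,$$ where $\Delta(R(l))=R(l)_1\otimes R(l)_2$. A Hom-pre-Lie CoDer pair $(L,\Delta_0,\varphi_L,\alpha)$ is a vector space $L$ with linear maps $\Delta_0:L\to L\otimes L$, $\alpha,\varphi_L:L\to L$ such that $(1-\tau^{12})\circ\big((\Delta_0\otimes\alpha)\circ\Delta_0-(\alpha\otimes\Delta_0)\circ\Delta_0\big)=0$ and $\Delta_0\circ\varphi_L=(\varphi_L\otimes\alpha+\alpha\otimes\varphi_L)\circ\Delta_0$. *)

theory Defs
  imports "Jordan_Normal_Form.Missing_VectorSpace" "HOL-Algebra.AbelCoset"
begin

section \<open>Tensor products of vector spaces\<close>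

text \<open>
  The tensor product is the textbook one: the free vector space on
  \<open>carrier V \<times> carrier W\<close> (finitely supported functions), divided by the span of the
  bilinearity relations. Vector spaces are module records over a field \<open>K\<close>, so the construction
  can be iterated.
\<close>

definition free_space :: "('k, 'q) ring_scheme \<Rightarrow> 'x set \<Rightarrow> ('k, 'x \<Rightarrow> 'k) module" where
  "free_space K X = (ring.func_space K X)
     \<lparr>carrier := {f \<in> X \<rightarrow>\<^sub>E carrier K. finite {x \<in> X. f x \<noteq> \<zero>\<^bsub>K\<^esub>}}\<rparr>"

definition free_gen :: "('k, 'q) ring_scheme \<Rightarrow> 'x set \<Rightarrow> 'x \<Rightarrow> 'x \<Rightarrow> 'k" where
  "free_gen K X x = (\<lambda>y\<in>X. if y = x then \<one>\<^bsub>K\<^esub> else \<zero>\<^bsub>K\<^esub>)"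

text \<open>
  The fields \<open>mult\<close> and \<open>one\<close> only exist because module records extend ring records;
  they carry no meaning for vector spaces.
\<close>

definition quotient_space :: "('k, 'v, 'm) module_scheme \<Rightarrow> 'v set \<Rightarrow> ('k, 'v set) module" where
  "quotient_space V N =
     \<lparr>carrier = a_rcosets\<^bsub>V\<^esub> N,
      mult = (\<lambda>A B. N),
      one = N,
      zero = N,
      add = (\<lambda>A B. A <+>\<^bsub>V\<^esub> B),
      smult = (\<lambda>c A. \<Union>v\<in>A. N +>\<^bsub>V\<^esub> (c \<odot>\<^bsub>V\<^esub> v))\<rparr>"

definition tensor_free ::
  "('k, 'q) ring_scheme \<Rightarrow> ('k, 'v, 'm) module_scheme \<Rightarrow> ('k, 'w, 'n) module_scheme
    \<Rightarrow> ('k, 'v \<times> 'w \<Rightarrow> 'k) module" where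
  "tensor_free K V W = free_space K (carrier V \<times> carrier W)"

definition tensor_gen ::
  "('k, 'q) ring_scheme \<Rightarrow> ('k, 'v, 'm) module_scheme \<Rightarrow> ('k, 'w, 'n) module_scheme
    \<Rightarrow> 'v \<Rightarrow> 'w \<Rightarrow> 'v \<times> 'w \<Rightarrow> 'k" where
  "tensor_gen K V W x y = free_gen K (carrier V \<times> carrier W) (x, y)"

definition tensor_relations ::
  "('k, 'q) ring_scheme \<Rightarrow> ('k, 'v, 'm) module_scheme \<Rightarrow> ('k, 'w, 'n) module_scheme
    \<Rightarrow> ('v \<times> 'w \<Rightarrow> 'k) set" where
  "tensor_relations K V W = (let F = tensor_free K V W; e = tensor_gen K V W in
     {e (x \<oplus>\<^bsub>V\<^esub> x') y \<ominus>\<^bsub>F\<^esub> (e x y \<oplus>\<^bsub>F\<^esub> e x' y) | x x' y.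
        x \<in> carrier V \<and> x' \<in> carrier V \<and> y \<in> carrier W}
   \<union> {e x (y \<oplus>\<^bsub>W\<^esub> y') \<ominus>\<^bsub>F\<^esub> (e x y \<oplus>\<^bsub>F\<^esub> e x y') | x y y'.
        x \<in> carrier V \<and> y \<in> carrier W \<and> y' \<in> carrier W}
   \<union> {e (c \<odot>\<^bsub>V\<^esub> x) y \<ominus>\<^bsub>F\<^esub> (c \<odot>\<^bsub>F\<^esub> e x y) | c x y.
        c \<in> carrier K \<and> x \<in> carrier V \<and> y \<in> carrier W}
   \<union> {e x (c \<odot>\<^bsub>W\<^esub> y) \<ominus>\<^bsub>F\<^esub> (c \<odot>\<^bsub>F\<^esub> e x y) | c x y.
        c \<in> carrier K \<and> x \<in> carrier V \<and> y \<in> carrier W})"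

definition tensor_null ::
  "('k, 'q) ring_scheme \<Rightarrow> ('k, 'v, 'm) module_scheme \<Rightarrow> ('k, 'w, 'n) module_scheme
    \<Rightarrow> ('v \<times> 'w \<Rightarrow> 'k) set" where
  "tensor_null K V W = module.span K (tensor_free K V W) (tensor_relations K V W)"

definition tensor ::
  "('k, 'q) ring_scheme \<Rightarrow> ('k, 'v, 'm) module_scheme \<Rightarrow> ('k, 'w, 'n) module_scheme
    \<Rightarrow> ('k, ('v \<times> 'w \<Rightarrow> 'k) set) module" where
  "tensor K V W = quotient_space (tensor_free K V W) (tensor_null K V W)"

definition pure_tensor ::
  "('k, 'q) ring_scheme \<Rightarrow> ('k, 'v, 'm) module_scheme \<Rightarrow> ('k, 'w, 'n) module_scheme
    \<Rightarrow> 'v \<Rightarrow> 'w \<Rightarrow> ('v \<times> 'w \<Rightarrow> 'k) set" where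
  "pure_tensor K V W x y = tensor_null K V W +>\<^bsub>tensor_free K V W\<^esub> tensor_gen K V W x y"

text \<open>
  The linear map on \<open>V \<otimes> W\<close> induced by a bilinear map \<open>b\<close> into \<open>P\<close>: write a tensor as a finite sum
  of terms \<open>f (x, y) \<cdot> (x \<otimes> y)\<close> and map it to the sum of the \<open>f (x, y) \<cdot> b x y\<close>. For bilinear
  \<open>b\<close> the result does not depend on the chosen representative \<open>f\<close>;
  no other case is used.
\<close>

definition tensor_lift ::
  "('k, 'q) ring_scheme \<Rightarrow> ('k, 'v, 'm) module_scheme \<Rightarrow> ('k, 'w, 'n) module_scheme
    \<Rightarrow> ('k, 'p, 'r) module_scheme \<Rightarrow> ('v \<Rightarrow> 'w \<Rightarrow> 'p) \<Rightarrow> ('v \<times> 'w \<Rightarrow> 'k) set \<Rightarrow> 'p" where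
  "tensor_lift K V W P b A = (let f = (SOME f. f \<in> A) in
     \<Oplus>\<^bsub>P\<^esub>p\<in>{p \<in> carrier V \<times> carrier W. f p \<noteq> \<zero>\<^bsub>K\<^esub>}. f p \<odot>\<^bsub>P\<^esub> b (fst p) (snd p))"

text \<open>\<open>f \<otimes> g : V \<otimes> W \<rightarrow> V' \<otimes> W'\<close>\<close>
definition tensor_map ::
  "('k, 'q) ring_scheme \<Rightarrow> ('k, 'v, 'm) module_scheme \<Rightarrow> ('k, 'w, 'n) module_scheme
    \<Rightarrow> ('k, 'v1, 'm1) module_scheme \<Rightarrow> ('k, 'w1, 'n1) module_scheme
    \<Rightarrow> ('v \<Rightarrow> 'v1) \<Rightarrow> ('w \<Rightarrow> 'w1) \<Rightarrow> ('v \<times> 'w \<Rightarrow> 'k) set \<Rightarrow> ('v1 \<times> 'w1 \<Rightarrow> 'k) set" where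
  "tensor_map K V W V' W' f g =
     tensor_lift K V W (tensor K V' W') (\<lambda>x y. pure_tensor K V' W' (f x) (g y))"

text \<open>The flip \<open>x \<otimes> y \<mapsto> y \<otimes> x\<close>\<close>
definition tensor_flip ::
  "('k, 'q) ring_scheme \<Rightarrow> ('k, 'v, 'm) module_scheme \<Rightarrow> ('k, 'w, 'n) module_scheme
    \<Rightarrow> ('v \<times> 'w \<Rightarrow> 'k) set \<Rightarrow> ('w \<times> 'v \<Rightarrow> 'k) set" where
  "tensor_flip K V W = tensor_lift K V W (tensor K W V) (\<lambda>x y. pure_tensor K W V y x)"

text \<open>The canonical identification \<open>x \<otimes> (y \<otimes> z) \<mapsto> (x \<otimes> y) \<otimes> z\<close>\<close>
definition tensor_assoc ::
  "('k, 'q) ring_scheme \<Rightarrow> ('k, 'u, 'l) module_scheme \<Rightarrow> ('k, 'v, 'm) module_scheme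
    \<Rightarrow> ('k, 'w, 'n) module_scheme \<Rightarrow> ('u \<times> ('v \<times> 'w \<Rightarrow> 'k) set \<Rightarrow> 'k) set
    \<Rightarrow> (('u \<times> 'v \<Rightarrow> 'k) set \<times> 'w \<Rightarrow> 'k) set" where
  "tensor_assoc K U V W =
     tensor_lift K U (tensor K V W) (tensor K (tensor K U V) W)
       (\<lambda>x. tensor_lift K V W (tensor K (tensor K U V) W)
         (\<lambda>y z. pure_tensor K (tensor K U V) W (pure_tensor K U V x y) z))"


section \<open>Coderivation pairs\<close>

locale vectorspace_char_0 = vectorspace K L
  for K :: "('k, 'q) ring_scheme" and L :: "('k, 'a, 'm) module_scheme" +
  assumes char_0: "\<And>n::nat. n > 0 \<Longrightarrow> [n] \<cdot>\<^bsub>K\<^esub> \<one>\<^bsub>K\<^esub> \<noteq> \<zero>\<^bsub>K\<^esub>"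
begin

text \<open>\<open>L \<otimes> L \<otimes> L\<close> is read as \<open>(L \<otimes> L) \<otimes> L\<close>.\<close>

abbreviation L2 where "L2 \<equiv> tensor K L L"
abbreviation L3 where "L3 \<equiv> tensor K L2 L"

text \<open>\<open>f \<otimes> g\<close> for endomorphisms \<open>f, g\<close> of \<open>L\<close>\<close>
abbreviation tensor_endo where
  "tensor_endo f g \<equiv> tensor_map K L L L L f g"

text \<open>\<open>D \<otimes> f\<close> and \<open>f \<otimes> D\<close> as maps \<open>L \<otimes> L \<rightarrow> L \<otimes> L \<otimes> L\<close>, for \<open>D : L \<rightarrow> L \<otimes> L\<close> and \<open>f : L \<rightarrow> L\<close>\<close>
abbreviation coprod_left where
  "coprod_left D f t \<equiv> tensor_map K L L L2 L D f t"
abbreviation coprod_right where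
  "coprod_right f D t \<equiv> tensor_assoc K L L L (tensor_map K L L L L2 f D t)"

abbreviation tau where "tau \<equiv> tensor_flip K L L"
abbreviation tau12 where "tau12 \<equiv> tensor_map K L2 L L2 L tau (\<lambda>z. z)"

end

locale hom_coass_coder_pair = vectorspace_char_0 K L
  for K :: "('k, 'q) ring_scheme" and L :: "('k, 'a, 'm) module_scheme"
    and \<Delta> :: "'a \<Rightarrow> ('a \<times> 'a \<Rightarrow> 'k) set" and \<phi> :: "'a \<Rightarrow> 'a" and \<alpha> :: "'a \<Rightarrow> 'a" +
  assumes linear_Delta: "linear_map K L L2 \<Delta>"
    and linear_phi: "linear_map K L L \<phi>"
    and linear_alpha: "linear_map K L L \<alpha>"
    and hom_coass: "\<And>l. l \<in> carrier L \<Longrightarrow> coprod_right \<alpha> \<Delta> (\<Delta> l) = coprod_left \<Delta> \<alpha> (\<Delta> l)"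
    and coder: "\<And>l. l \<in> carrier L \<Longrightarrow>
      \<Delta> (\<phi> l) = tensor_endo \<phi> \<alpha> (\<Delta> l) \<oplus>\<^bsub>L2\<^esub> tensor_endo \<alpha> \<phi> (\<Delta> l)"

locale rota_baxter_hom_coass_coder_pair = hom_coass_coder_pair K L \<Delta> \<phi> \<alpha>
  for K :: "('k, 'q) ring_scheme" and L :: "('k, 'a, 'm) module_scheme"
    and \<Delta> \<phi> \<alpha> and R :: "'a \<Rightarrow> 'a" and w :: 'k +
  assumes weight: "w \<in> carrier K"
    and linear_R: "linear_map K L L R"
    and R_alpha: "\<And>l. l \<in> carrier L \<Longrightarrow> R (\<alpha> l) = \<alpha> (R l)"
    and phi_R: "\<And>l. l \<in> carrier L \<Longrightarrow> \<phi> (R l) = R (\<phi> l)"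
    and rota_baxter: "\<And>l. l \<in> carrier L \<Longrightarrow>
      tensor_endo R R (\<Delta> l) =
        tensor_endo (\<lambda>x. x) R (\<Delta> (R l)) \<oplus>\<^bsub>L2\<^esub> tensor_endo R (\<lambda>x. x) (\<Delta> (R l))
          \<oplus>\<^bsub>L2\<^esub> w \<odot>\<^bsub>L2\<^esub> \<Delta> (R l)"

locale hom_pre_lie_coder_pair = vectorspace_char_0 K L
  for K :: "('k, 'q) ring_scheme" and L :: "('k, 'a, 'm) module_scheme"
    and \<Delta>0 :: "'a \<Rightarrow> ('a \<times> 'a \<Rightarrow> 'k) set" and \<phi> :: "'a \<Rightarrow> 'a" and \<alpha> :: "'a \<Rightarrow> 'a" +
  assumes linear_Delta0: "linear_map K L L2 \<Delta>0"
    and linear_phi: "linear_map K L L \<phi>"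
    and linear_alpha: "linear_map K L L \<alpha>"
    and hom_pre_lie: "\<And>l. l \<in> carrier L \<Longrightarrow>
      (let t = coprod_left \<Delta>0 \<alpha> (\<Delta>0 l) \<ominus>\<^bsub>L3\<^esub> coprod_right \<alpha> \<Delta>0 (\<Delta>0 l)
       in t \<ominus>\<^bsub>L3\<^esub> tau12 t) = \<zero>\<^bsub>L3\<^esub>"
    and coder: "\<And>l. l \<in> carrier L \<Longrightarrow>
      \<Delta>0 (\<phi> l) = tensor_endo \<phi> \<alpha> (\<Delta>0 l) \<oplus>\<^bsub>L2\<^esub> tensor_endo \<alpha> \<phi> (\<Delta>0 l)"

end

theory Submission
  imports Defs
begin

text \<open>
  Put \<open>\<Gamma> = \<Delta> - \<tau> \<circ> \<Delta>\<close>. Since the flip exchanges the two factors of \<open>1 \<otimes> R\<close>, the map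
  in question is \<open>P = (R \<otimes> 1) \<circ> \<Gamma>\<close>. This is the dual of a familiar fact: a Rota--Baxter
  operator \<open>R\<close> of weight \<open>0\<close> on a Lie algebra makes \<open>[R x, y]\<close> a pre-Lie product, and an
  associative product yields a Lie bracket by antisymmetrisation. The proof follows these two steps.

  First, \<open>\<Gamma>\<close> satisfies the Hom-co-Jacobi identity
  \<open>(1 - \<tau>\<^sup>1\<^sup>2) (\<alpha> \<otimes> \<Gamma>) \<Gamma> = (\<Gamma> \<otimes> \<alpha>) \<Gamma>\<close> (\<open>hom_co_jacobi\<close>). By Hom-coassociativity
  \<open>X = (\<Delta> \<otimes> \<alpha>) (\<Delta> l) = (\<alpha> \<otimes> \<Delta>) (\<Delta> l)\<close>, and all terms of the identity are images of
  this one \<open>X\<close> under permutations of the three factors, so that they can be cancelled.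

  Second, the Rota--Baxter identity says \<open>(1 - \<tau>) \<circ> P \<circ> R = (R \<otimes> R) \<circ> \<Gamma>\<close>
  (\<open>commutator_pre_lie_coproduct_R\<close>). This gives
  \<open>(1 - \<tau>\<^sup>1\<^sup>2) (P \<otimes> \<alpha>) P = (R \<otimes> R \<otimes> 1) (\<Gamma> \<otimes> \<alpha>) \<Gamma>\<close>, while
  \<open>(\<alpha> \<otimes> P) P = (R \<otimes> R \<otimes> 1) (\<alpha> \<otimes> \<Gamma>) \<Gamma>\<close> holds because \<open>R\<close> commutes with \<open>\<alpha>\<close>.
  The pre-Lie identity for \<open>P\<close> is therefore the image of the co-Jacobi identity
  for \<open>\<Gamma>\<close> under \<open>R \<otimes> R \<otimes> 1\<close>. The coderivation property passes from \<open>\<Delta>\<close> to \<open>\<Gamma>\<close>, because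
  the flip interchanges \<open>\<phi> \<otimes> \<alpha>\<close> and \<open>\<alpha> \<otimes> \<phi>\<close>, and from \<open>\<Gamma>\<close> to \<open>P\<close>, because \<open>R\<close> commutes
  with \<open>\<phi>\<close> and \<open>\<alpha>\<close>.

  All this uses the tensor product only through its universal property: linear maps out of
  \<open>V \<otimes> W\<close> correspond to bilinear maps (\<open>linear_map_tensor_lift\<close>, \<open>tensor_lift_pure\<close>), and they
  agree as soon as they agree on pure tensors (\<open>tensor_linear_map_eq\<close>). The
  property is derived for the quotient of a free space from the corresponding
  facts about free spaces and quotients.
\<close>

section \<open>Linear maps\<close>

lemma linear_mapI:
  assumes "vectorspace K V" "vectorspace K W"
    and "\<And>x. x \<in> carrier V \<Longrightarrow> f x \<in> carrier W"
    and "\<And>x y. \<lbrakk>x \<in> carrier V; y \<in> carrier V\<rbrakk> \<Longrightarrow> f (x \<oplus>\<^bsub>V\<^esub> y) = f x \<oplus>\<^bsub>W\<^esub> f y"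
    and "\<And>c x. \<lbrakk>c \<in> carrier K; x \<in> carrier V\<rbrakk> \<Longrightarrow> f (c \<odot>\<^bsub>V\<^esub> x) = c \<odot>\<^bsub>W\<^esub> f x"
  shows "linear_map K V W f"
  using assms
  by (auto simp: linear_map_def mod_hom_def mod_hom_axioms_def module_hom_def vectorspace_def)

lemma linear_map_domain: "linear_map K V W f \<Longrightarrow> vectorspace K V"
  and linear_map_codomain: "linear_map K V W f \<Longrightarrow> vectorspace K W"
  by (simp_all add: linear_map_def)

lemma linear_map_id: "vectorspace K V \<Longrightarrow> linear_map K V V (\<lambda>x. x)"
  by (rule linear_mapI) auto

lemma linear_map_comp:
  assumes f: "linear_map K U V f" and g: "linear_map K V W g"
  shows "linear_map K U W (\<lambda>x. g (f x))"
proof -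
  interpret f: linear_map K U V f by fact
  interpret g: linear_map K V W g by fact
  show ?thesis
    by (rule linear_mapI) (simp_all add: f.V.vectorspace_axioms g.W.vectorspace_axioms)
qed

lemma linear_map_minus:
  assumes f: "linear_map K V W f" and g: "linear_map K V W g"
  shows "linear_map K V W (\<lambda>x. f x \<ominus>\<^bsub>W\<^esub> g x)"
proof -
  interpret W: vectorspace K W using f by (rule linear_map_codomain)
  interpret f: linear_map K V W f by fact
  interpret g: linear_map K V W g by fact
  show ?thesis
  proof (rule linear_mapI)
    fix x y assume "x \<in> carrier V" "y \<in> carrier V"
    then show "f (x \<oplus>\<^bsub>V\<^esub> y) \<ominus>\<^bsub>W\<^esub> g (x \<oplus>\<^bsub>V\<^esub> y) = f x \<ominus>\<^bsub>W\<^esub> g x \<oplus>\<^bsub>W\<^esub> (f y \<ominus>\<^bsub>W\<^esub> g y)"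
      by (simp add: a_minus_def W.minus_add W.a_ac)
  next
    fix c x assume "c \<in> carrier K" "x \<in> carrier V"
    then show "f (c \<odot>\<^bsub>V\<^esub> x) \<ominus>\<^bsub>W\<^esub> g (c \<odot>\<^bsub>V\<^esub> x) = c \<odot>\<^bsub>W\<^esub> (f x \<ominus>\<^bsub>W\<^esub> g x)"
      by (simp add: a_minus_def W.smult_r_distr W.smult_r_minus)
  qed (simp_all add: f.V.vectorspace_axioms W.vectorspace_axioms)
qed

lemma linear_map_add:
  assumes f: "linear_map K V W f" and g: "linear_map K V W g"
  shows "linear_map K V W (\<lambda>x. f x \<oplus>\<^bsub>W\<^esub> g x)"
proof -
  interpret W: vectorspace K W using f by (rule linear_map_codomain)
  interpret f: linear_map K V W f by fact
  interpret g: linear_map K V W g by fact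
  show ?thesis
  proof (rule linear_mapI)
    fix x y assume "x \<in> carrier V" "y \<in> carrier V"
    then show "f (x \<oplus>\<^bsub>V\<^esub> y) \<oplus>\<^bsub>W\<^esub> g (x \<oplus>\<^bsub>V\<^esub> y) = f x \<oplus>\<^bsub>W\<^esub> g x \<oplus>\<^bsub>W\<^esub> (f y \<oplus>\<^bsub>W\<^esub> g y)"
      by (simp add: W.a_ac)
  next
    fix c x assume "c \<in> carrier K" "x \<in> carrier V"
    then show "f (c \<odot>\<^bsub>V\<^esub> x) \<oplus>\<^bsub>W\<^esub> g (c \<odot>\<^bsub>V\<^esub> x) = c \<odot>\<^bsub>W\<^esub> (f x \<oplus>\<^bsub>W\<^esub> g x)"
      by (simp add: W.smult_r_distr)
  qed (simp_all add: f.V.vectorspace_axioms W.vectorspace_axioms)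
qed

lemma linear_map_scale:
  assumes f: "linear_map K V W f" and c: "c \<in> carrier K"
  shows "linear_map K V W (\<lambda>x. c \<odot>\<^bsub>W\<^esub> f x)"
proof -
  interpret W: vectorspace K W using f by (rule linear_map_codomain)
  interpret f: linear_map K V W f by fact
  show ?thesis
  proof (rule linear_mapI)
    fix x y assume "x \<in> carrier V" "y \<in> carrier V"
    then show "c \<odot>\<^bsub>W\<^esub> f (x \<oplus>\<^bsub>V\<^esub> y) = c \<odot>\<^bsub>W\<^esub> f x \<oplus>\<^bsub>W\<^esub> c \<odot>\<^bsub>W\<^esub> f y"
      using c by (simp add: W.smult_r_distr)
  next
    fix d x assume "d \<in> carrier K" "x \<in> carrier V"
    then show "c \<odot>\<^bsub>W\<^esub> f (d \<odot>\<^bsub>V\<^esub> x) = d \<odot>\<^bsub>W\<^esub> (c \<odot>\<^bsub>W\<^esub> f x)"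
      using c by (simp add: W.smult_assoc1[symmetric] W.R.m_comm)
  qed (simp_all add: f.V.vectorspace_axioms W.vectorspace_axioms c)
qed

lemma linear_map_cong:
  assumes g: "linear_map K V W g" and eq: "\<And>x. x \<in> carrier V \<Longrightarrow> f x = g x"
  shows "linear_map K V W f"
proof -
  interpret V: vectorspace K V using g by (rule linear_map_domain)
  interpret g: linear_map K V W g by fact
  show ?thesis
    by (rule linear_mapI) (simp_all add: eq V.vectorspace_axioms g.W.vectorspace_axioms)
qed

text \<open>
  The vector space axioms are equations, so they are inherited along a surjection that
  respects the operations. For a quotient this reduces every axiom to the two computations
  \<open>coset_add\<close> and \<open>coset_smult\<close> below.
\<close>
lemma vectorspace_surjective_image:
  assumes V: "vectorspace K V"
    and onto: "carrier Q = f ` carrier V"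
    and add: "\<And>x y. \<lbrakk>x \<in> carrier V; y \<in> carrier V\<rbrakk> \<Longrightarrow> f x \<oplus>\<^bsub>Q\<^esub> f y = f (x \<oplus>\<^bsub>V\<^esub> y)"
    and smult: "\<And>c x. \<lbrakk>c \<in> carrier K; x \<in> carrier V\<rbrakk> \<Longrightarrow> c \<odot>\<^bsub>Q\<^esub> f x = f (c \<odot>\<^bsub>V\<^esub> x)"
    and zero: "\<zero>\<^bsub>Q\<^esub> = f \<zero>\<^bsub>V\<^esub>"
  shows "vectorspace K Q"
proof -
  interpret V: vectorspace K V by fact
  have neg: "\<exists>y\<in>carrier V. f (x \<oplus>\<^bsub>V\<^esub> y) = f \<zero>\<^bsub>V\<^esub>" if "x \<in> carrier V" for x
    using that by (intro bexI[of _ "\<ominus>\<^bsub>V\<^esub> x"]) (simp_all add: V.r_neg)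
  show ?thesis
  proof (rule vs_criteria)
    show "field K" ..
  qed (auto simp: onto add smult zero neg V.smult_assoc1 V.smult_l_distr V.smult_r_distr V.a_ac)
qed

section \<open>Free vector spaces\<close>

context field
begin

lemma free_space_carrier:
  "f \<in> carrier (free_space R X) \<longleftrightarrow> f \<in> X \<rightarrow>\<^sub>E carrier R \<and> finite {x \<in> X. f x \<noteq> \<zero>}"
  by (simp add: free_space_def)

lemma free_space_ops:
  "f \<oplus>\<^bsub>free_space R X\<^esub> g = (\<lambda>x\<in>X. f x \<oplus> g x)"
  "c \<odot>\<^bsub>free_space R X\<^esub> f = (\<lambda>x\<in>X. c \<otimes> f x)"
  "\<zero>\<^bsub>free_space R X\<^esub> = (\<lambda>x\<in>X. \<zero>)"
  by (simp_all add: free_space_def func_space_def)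

text \<open>
  The support of a sum lies in the union of the supports, so the finitely supported functions
  form a subspace of all functions.
\<close>
lemma vectorspace_free_space: "vectorspace R (free_space R X)"
proof -
  interpret F: module R "func_space X" by (rule func_space_is_module)
  let ?N = "{f \<in> X \<rightarrow>\<^sub>E carrier R. finite {x \<in> X. f x \<noteq> \<zero>}}"
  have fin: "finite {x \<in> X. f x \<oplus> g x \<noteq> \<zero>}"
    if "finite {x \<in> X. f x \<noteq> \<zero>}" "finite {x \<in> X. g x \<noteq> \<zero>}" for f g
    by (rule finite_subset[OF _ finite_UnI[OF that]]) auto
  have fin2: "finite {x \<in> X. c \<otimes> f x \<noteq> \<zero>}"
    if "finite {x \<in> X. f x \<noteq> \<zero>}" "c \<in> carrier R" for c f
    by (rule finite_subset[OF _ that(1)]) (use that in auto)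
  have "LinearCombinations.submodule R ?N (func_space X)"
    by (rule LinearCombinations.submodule.intro)
       (use F.module_axioms in \<open>auto simp: func_space_def fin fin2 PiE_iff extensional_def cong: conj_cong\<close>)
  then have "module R (free_space R X)"
    unfolding free_space_def by (rule F.submodule_is_module)
  then show ?thesis
    by (simp add: vectorspace_def field_axioms)
qed


text \<open>
  The linear extension of a map \<open>h\<close> given on the generators. Only the support of \<open>f\<close> is summed
  over, which keeps the sum finite.
\<close>
definition free_extend :: "'x set \<Rightarrow> ('a, 'p, 'r) module_scheme \<Rightarrow> ('x \<Rightarrow> 'p) \<Rightarrow> ('x \<Rightarrow> 'a) \<Rightarrow> 'p" where
  "free_extend X P h f = (\<Oplus>\<^bsub>P\<^esub>x\<in>{x \<in> X. f x \<noteq> \<zero>}. f x \<odot>\<^bsub>P\<^esub> h x)"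

lemma free_gen_closed [simp]: "x \<in> X \<Longrightarrow> free_gen R X x \<in> carrier (free_space R X)"
  by (auto simp: free_space_carrier free_gen_def)

lemma free_extend_gen:
  assumes "vectorspace R P" and "x \<in> X" and "h x \<in> carrier P"
  shows "free_extend X P h (free_gen R X x) = h x"
proof -
  interpret P: vectorspace R P by fact
  have "{y \<in> X. free_gen R X x y \<noteq> \<zero>} = {x}"
    using assms(2) by (auto simp: free_gen_def)
  then show ?thesis
    using assms(2,3) by (simp add: free_extend_def free_gen_def)
qed

text \<open>
  The range of summation depends on the argument, which hides the additivity. It becomes
  visible once the sums for \<open>f\<close>, \<open>g\<close> and \<open>f + g\<close> are all taken over one finite set
  containing both supports; the extra terms vanish.
\<close>
lemma linear_map_free_extend:
  assumes "vectorspace R P" and h: "h \<in> X \<rightarrow> carrier P"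
  shows "linear_map R (free_space R X) P (free_extend X P h)"
proof -
  interpret P: vectorspace R P by fact
  have h': "h x \<in> carrier P" if "x \<in> X" for x
    using h that by auto
  have superset: "free_extend X P h f = (\<Oplus>\<^bsub>P\<^esub>x\<in>S. f x \<odot>\<^bsub>P\<^esub> h x)"
    if "finite S" "{x \<in> X. f x \<noteq> \<zero>} \<subseteq> S" "S \<subseteq> X" "f \<in> X \<rightarrow> carrier R" for f S
    unfolding free_extend_def
  proof (rule P.add.finprod_mono_neutral_cong_left)
    show "(\<lambda>x. f x \<odot>\<^bsub>P\<^esub> h x) \<in> S \<rightarrow> carrier P"
      using that(3,4) h' by (auto intro!: P.smult_closed)
  qed (use that h' in auto)
  show ?thesis
  proof (rule linear_mapI)
    show "vectorspace R (free_space R X)" by (rule vectorspace_free_space)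
  next
    fix f assume "f \<in> carrier (free_space R X)"
    then show "free_extend X P h f \<in> carrier P"
      using h' by (auto simp: free_extend_def free_space_carrier intro!: P.finsum_closed P.smult_closed)
  next
    fix f g assume f: "f \<in> carrier (free_space R X)" and g: "g \<in> carrier (free_space R X)"
    define S where "S = {x \<in> X. f x \<noteq> \<zero>} \<union> {x \<in> X. g x \<noteq> \<zero>}"
    have S: "finite S" "S \<subseteq> X"
      using f g by (auto simp: S_def free_space_carrier)
    have cl: "f x \<in> carrier R" "g x \<in> carrier R" "h x \<in> carrier P" if "x \<in> S" for x
      using that f g h' S by (auto simp: free_space_carrier)
    have "free_extend X P h (f \<oplus>\<^bsub>free_space R X\<^esub> g)
        = (\<Oplus>\<^bsub>P\<^esub>x\<in>S. (f \<oplus>\<^bsub>free_space R X\<^esub> g) x \<odot>\<^bsub>P\<^esub> h x)"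
      using f g by (intro superset S) (auto simp: free_space_ops free_space_carrier S_def)
    also have "\<dots> = (\<Oplus>\<^bsub>P\<^esub>x\<in>S. f x \<odot>\<^bsub>P\<^esub> h x \<oplus>\<^bsub>P\<^esub> g x \<odot>\<^bsub>P\<^esub> h x)"
      using S cl by (intro P.finsum_cong') (auto simp: free_space_ops P.smult_l_distr)
    also have "\<dots> = (\<Oplus>\<^bsub>P\<^esub>x\<in>S. f x \<odot>\<^bsub>P\<^esub> h x) \<oplus>\<^bsub>P\<^esub> (\<Oplus>\<^bsub>P\<^esub>x\<in>S. g x \<odot>\<^bsub>P\<^esub> h x)"
      using cl by (intro P.finsum_addf) auto
    also have "(\<Oplus>\<^bsub>P\<^esub>x\<in>S. f x \<odot>\<^bsub>P\<^esub> h x) = free_extend X P h f"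
      using f by (intro superset[symmetric] S) (auto simp: free_space_carrier S_def)
    also have "(\<Oplus>\<^bsub>P\<^esub>x\<in>S. g x \<odot>\<^bsub>P\<^esub> h x) = free_extend X P h g"
      using g by (intro superset[symmetric] S) (auto simp: free_space_carrier S_def)
    finally show "free_extend X P h (f \<oplus>\<^bsub>free_space R X\<^esub> g) = free_extend X P h f \<oplus>\<^bsub>P\<^esub> free_extend X P h g" .
  next
    fix c f assume c: "c \<in> carrier R" and f: "f \<in> carrier (free_space R X)"
    define S where "S = {x \<in> X. f x \<noteq> \<zero>}"
    have S: "finite S" "S \<subseteq> X"
      using f by (auto simp: S_def free_space_carrier)
    have cl: "f x \<in> carrier R" "h x \<in> carrier P" if "x \<in> S" for x
      using that f h' S by (auto simp: free_space_carrier)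
    have "free_extend X P h (c \<odot>\<^bsub>free_space R X\<^esub> f)
        = (\<Oplus>\<^bsub>P\<^esub>x\<in>S. (c \<odot>\<^bsub>free_space R X\<^esub> f) x \<odot>\<^bsub>P\<^esub> h x)"
      using f c by (intro superset S) (auto simp: free_space_ops free_space_carrier S_def)
    also have "\<dots> = (\<Oplus>\<^bsub>P\<^esub>x\<in>S. c \<odot>\<^bsub>P\<^esub> (f x \<odot>\<^bsub>P\<^esub> h x))"
      using S cl c by (intro P.finsum_cong') (auto simp: free_space_ops P.smult_assoc1)
    also have "\<dots> = c \<odot>\<^bsub>P\<^esub> (\<Oplus>\<^bsub>P\<^esub>x\<in>S. f x \<odot>\<^bsub>P\<^esub> h x)"
      using S cl c by (intro P.finsum_smult_ldistr[symmetric]) auto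
    also have "(\<Oplus>\<^bsub>P\<^esub>x\<in>S. f x \<odot>\<^bsub>P\<^esub> h x) = free_extend X P h f"
      by (simp add: free_extend_def S_def)
    finally show "free_extend X P h (c \<odot>\<^bsub>free_space R X\<^esub> f) = c \<odot>\<^bsub>P\<^esub> free_extend X P h f" .
  qed fact
qed

text \<open>
  The generators span: removing one point \<open>x\<close> from the support of \<open>f\<close> subtracts a
  multiple of the generator at \<open>x\<close>, so induction on the support applies.
\<close>
lemma free_space_linear_map_eq:
  assumes F: "linear_map R (free_space R X) P F" and G: "linear_map R (free_space R X) P G"
    and gen: "\<And>x. x \<in> X \<Longrightarrow> F (free_gen R X x) = G (free_gen R X x)"
    and f: "f \<in> carrier (free_space R X)"
  shows "F f = G f"
proof -
  interpret Fr: vectorspace R "free_space R X" by (rule vectorspace_free_space)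
  interpret F: linear_map R "free_space R X" P F by fact
  interpret G: linear_map R "free_space R X" P G by fact
  have "F f = G f" if "finite S" "{x \<in> X. f x \<noteq> \<zero>} \<subseteq> S" "S \<subseteq> X" "f \<in> carrier (free_space R X)" for S f
    using that
  proof (induction S arbitrary: f)
    case empty
    then have "f = \<zero>\<^bsub>free_space R X\<^esub>"
      by (auto simp: free_space_ops free_space_carrier fun_eq_iff PiE_def extensional_def)
    then show ?case by simp
  next
    case (insert x S)
    let ?g = "\<lambda>y\<in>X. if y = x then \<zero> else f y"
    have x: "x \<in> X" "f x \<in> carrier R"
      using insert.prems by (auto simp: free_space_carrier)
    have supp: "{y \<in> X. ?g y \<noteq> \<zero>} \<subseteq> S"
      using insert.prems by auto
    have g: "?g \<in> carrier (free_space R X)"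
      using insert.prems finite_subset[OF supp insert.hyps(1)] by (auto simp: free_space_carrier)
    have f: "f = ?g \<oplus>\<^bsub>free_space R X\<^esub> f x \<odot>\<^bsub>free_space R X\<^esub> free_gen R X x"
      using x insert.prems
      by (auto simp: free_space_ops free_space_carrier free_gen_def fun_eq_iff PiE_def extensional_def Pi_def)
    have "F ?g = G ?g"
      using insert.prems by (intro insert.IH supp g) auto
    then have "F (?g \<oplus>\<^bsub>free_space R X\<^esub> f x \<odot>\<^bsub>free_space R X\<^esub> free_gen R X x)
        = G (?g \<oplus>\<^bsub>free_space R X\<^esub> f x \<odot>\<^bsub>free_space R X\<^esub> free_gen R X x)"
      using x g gen[OF x(1)] free_gen_closed[OF x(1)]
      by (simp only: F.T_add G.T_add F.T_smult G.T_smult Fr.smult_closed)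
    then show ?case
      by (simp only: f[symmetric])
  qed
  then show ?thesis
    using f by (auto simp: free_space_carrier)
qed

end

section \<open>Quotient spaces\<close>

context
  fixes K :: "('k, 'q) ring_scheme" and V :: "('k, 'v, 'm) module_scheme" and N :: "'v set"
  assumes V: "vectorspace K V" and N: "LinearCombinations.submodule K N V"
begin

interpretation V: vectorspace K V by (rule V)
interpretation N: LinearCombinations.submodule K N V by (rule N)

lemma abelian_subgroup_submodule: "abelian_subgroup N V"
proof (rule abelian_subgroupI3)
  have neg: "\<ominus>\<^bsub>V\<^esub> x \<in> N" if x: "x \<in> N" for x
  proof -
    have "(\<ominus>\<^bsub>K\<^esub> \<one>\<^bsub>K\<^esub>) \<odot>\<^bsub>V\<^esub> x \<in> N"
      by (intro N.smult_closed V.R.add.inv_closed V.R.one_closed x)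
    moreover have "(\<ominus>\<^bsub>K\<^esub> \<one>\<^bsub>K\<^esub>) \<odot>\<^bsub>V\<^esub> x = \<ominus>\<^bsub>V\<^esub> x"
      using x N.subset by (intro V.smult_minus_1) auto
    ultimately show ?thesis by simp
  qed
  have "subgroup N (add_monoid V)"
  proof (rule V.add.subgroupI)
    show "N \<noteq> {}" using N.zero_closed by blast
  qed (simp_all add: N.subset neg)
  then show "additive_subgroup N V"
    by (rule additive_subgroup.intro)
qed (rule V.abelian_group_axioms)

interpretation S: abelian_subgroup N V by (rule abelian_subgroup_submodule)

lemma coset_eq_iff:
  assumes "x \<in> carrier V" "y \<in> carrier V"
  shows "N +>\<^bsub>V\<^esub> x = N +>\<^bsub>V\<^esub> y \<longleftrightarrow> x \<ominus>\<^bsub>V\<^esub> y \<in> N"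
proof -
  have "N +>\<^bsub>V\<^esub> x = N +>\<^bsub>V\<^esub> y \<longleftrightarrow> x \<in> N +>\<^bsub>V\<^esub> y"
    using S.a_rcos_self[OF assms(1)] S.a_repr_independence'[OF _ assms(2)] by metis
  also have "\<dots> \<longleftrightarrow> x \<ominus>\<^bsub>V\<^esub> y \<in> N"
    unfolding a_minus_def by (rule S.a_rcos_module[OF assms(2,1)])
  finally show ?thesis .
qed

lemma coset_add:
  "\<lbrakk>x \<in> carrier V; y \<in> carrier V\<rbrakk> \<Longrightarrow>
    (N +>\<^bsub>V\<^esub> x) \<oplus>\<^bsub>quotient_space V N\<^esub> (N +>\<^bsub>V\<^esub> y) = N +>\<^bsub>V\<^esub> (x \<oplus>\<^bsub>V\<^esub> y)"
  by (simp add: quotient_space_def S.a_rcos_sum)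

text \<open>
  The scalar multiple of a coset is a union over all its representatives \<open>y\<close>; each of them
  contributes the same coset, since \<open>c y - c x = c (y - x)\<close> lies in \<open>N\<close>.
\<close>
lemma coset_smult:
  assumes c: "c \<in> carrier K" and x: "x \<in> carrier V"
  shows "c \<odot>\<^bsub>quotient_space V N\<^esub> (N +>\<^bsub>V\<^esub> x) = N +>\<^bsub>V\<^esub> (c \<odot>\<^bsub>V\<^esub> x)"
proof -
  have "N +>\<^bsub>V\<^esub> (c \<odot>\<^bsub>V\<^esub> y) = N +>\<^bsub>V\<^esub> (c \<odot>\<^bsub>V\<^esub> x)" if y: "y \<in> N +>\<^bsub>V\<^esub> x" for y
  proof -
    have yV: "y \<in> carrier V"
      using S.a_elemrcos_carrier x y by blast
    have "y \<ominus>\<^bsub>V\<^esub> x \<in> N"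
      using S.a_rcos_module_imp[OF x y] by (simp add: a_minus_def)
    then have "c \<odot>\<^bsub>V\<^esub> (y \<ominus>\<^bsub>V\<^esub> x) \<in> N"
      by (rule N.smult_closed[OF c])
    then have "c \<odot>\<^bsub>V\<^esub> y \<ominus>\<^bsub>V\<^esub> c \<odot>\<^bsub>V\<^esub> x \<in> N"
      using c x yV by (simp add: a_minus_def V.smult_r_distr V.smult_r_minus)
    then show ?thesis
      using c x yV by (simp add: coset_eq_iff)
  qed
  moreover have "x \<in> N +>\<^bsub>V\<^esub> x"
    using x by (rule S.a_rcos_self)
  ultimately have "(\<Union>y\<in>N +>\<^bsub>V\<^esub> x. N +>\<^bsub>V\<^esub> (c \<odot>\<^bsub>V\<^esub> y)) = N +>\<^bsub>V\<^esub> (c \<odot>\<^bsub>V\<^esub> x)"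
    by blast
  then show ?thesis
    by (simp add: quotient_space_def)
qed

lemma quotient_carrier: "carrier (quotient_space V N) = (\<lambda>x. N +>\<^bsub>V\<^esub> x) ` carrier V"
  by (auto simp: quotient_space_def A_RCOSETS_def')

lemma vectorspace_quotient: "vectorspace K (quotient_space V N)"
proof (rule vectorspace_surjective_image[OF V quotient_carrier coset_add coset_smult])
  show "\<zero>\<^bsub>quotient_space V N\<^esub> = N +>\<^bsub>V\<^esub> \<zero>\<^bsub>V\<^esub>"
    by (simp add: quotient_space_def S.a_rcos_const N.zero_closed)
qed

lemma linear_map_coset: "linear_map K V (quotient_space V N) (\<lambda>x. N +>\<^bsub>V\<^esub> x)"
  by (rule linear_mapI) (simp_all add: V vectorspace_quotient quotient_carrier coset_add coset_smult)

end

section \<open>The universal property of the tensor product\<close>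

definition bilinear_map ::
  "('k, 'q) ring_scheme \<Rightarrow> ('k, 'v, 'm) module_scheme \<Rightarrow> ('k, 'w, 'n) module_scheme
    \<Rightarrow> ('k, 'p, 'r) module_scheme \<Rightarrow> ('v \<Rightarrow> 'w \<Rightarrow> 'p) \<Rightarrow> bool" where
  "bilinear_map K V W P b \<longleftrightarrow>
     (\<forall>x\<in>carrier V. linear_map K W P (b x)) \<and> (\<forall>y\<in>carrier W. linear_map K V P (\<lambda>x. b x y))"

lemma bilinear_mapD:
  assumes "bilinear_map K V W P b"
  shows "x \<in> carrier V \<Longrightarrow> linear_map K W P (b x)"
    and "y \<in> carrier W \<Longrightarrow> linear_map K V P (\<lambda>x. b x y)"
  using assms by (simp_all add: bilinear_map_def)

lemma bilinear_mapI:
  assumes "\<And>x. x \<in> carrier V \<Longrightarrow> linear_map K W P (b x)"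
    and "\<And>y. y \<in> carrier W \<Longrightarrow> linear_map K V P (\<lambda>x. b x y)"
  shows "bilinear_map K V W P b"
  using assms by (simp add: bilinear_map_def)

context
  fixes K :: "('k, 'q) ring_scheme" and V :: "('k, 'v, 'm) module_scheme"
    and W :: "('k, 'w, 'n) module_scheme"
  assumes V: "vectorspace K V" and W: "vectorspace K W"
begin

interpretation V: vectorspace K V by (rule V)
interpretation W: vectorspace K W by (rule W)

private abbreviation "F \<equiv> tensor_free K V W"
private abbreviation "N \<equiv> tensor_null K V W"
private abbreviation "e \<equiv> tensor_gen K V W"

lemma vectorspace_tensor_free: "vectorspace K F"
  unfolding tensor_free_def by (rule V.vectorspace_free_space)

interpretation F: vectorspace K F by (rule vectorspace_tensor_free)

lemma tensor_gen_closed: "\<lbrakk>x \<in> carrier V; y \<in> carrier W\<rbrakk> \<Longrightarrow> e x y \<in> carrier F"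
  unfolding tensor_free_def tensor_gen_def by (rule V.free_gen_closed) simp

lemma tensor_relations_closed: "tensor_relations K V W \<subseteq> carrier F"
  by (auto simp: tensor_relations_def Let_def
      intro!: F.minus_closed F.a_closed F.smult_closed tensor_gen_closed)

lemma submodule_tensor_null: "LinearCombinations.submodule K N F"
  unfolding tensor_null_def by (rule F.span_is_submodule[OF tensor_relations_closed])

lemma tensor_relations_null: "r \<in> tensor_relations K V W \<Longrightarrow> r \<in> N"
  unfolding tensor_null_def using F.in_own_span[OF tensor_relations_closed] by blast

lemma vectorspace_tensor: "vectorspace K (tensor K V W)"
  unfolding tensor_def by (rule vectorspace_quotient[OF vectorspace_tensor_free submodule_tensor_null])

lemma linear_map_tensor_coset: "linear_map K F (tensor K V W) (\<lambda>f. N +>\<^bsub>F\<^esub> f)"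
  unfolding tensor_def by (rule linear_map_coset[OF vectorspace_tensor_free submodule_tensor_null])

interpretation T: vectorspace K "tensor K V W" by (rule vectorspace_tensor)
interpretation C: linear_map K F "tensor K V W" "\<lambda>f. N +>\<^bsub>F\<^esub> f" by (rule linear_map_tensor_coset)

lemma tensor_cosetE:
  assumes "t \<in> carrier (tensor K V W)"
  obtains f where "f \<in> carrier F" "t = N +>\<^bsub>F\<^esub> f"
  using assms quotient_carrier[OF vectorspace_tensor_free submodule_tensor_null]
  unfolding tensor_def by blast

lemma pure_tensor_closed [simp]:
  "\<lbrakk>x \<in> carrier V; y \<in> carrier W\<rbrakk> \<Longrightarrow> pure_tensor K V W x y \<in> carrier (tensor K V W)"
  unfolding pure_tensor_def by (rule C.T_im[OF tensor_gen_closed])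

text \<open>
  The bilinearity of \<open>\<otimes>\<close> below is this lemma applied to each of the four kinds of relations.
\<close>
lemma relation_coset:
  assumes "f \<ominus>\<^bsub>F\<^esub> g \<in> tensor_relations K V W" "f \<in> carrier F" "g \<in> carrier F"
  shows "N +>\<^bsub>F\<^esub> f = N +>\<^bsub>F\<^esub> g"
  using coset_eq_iff[OF vectorspace_tensor_free submodule_tensor_null] assms tensor_relations_null
  by blast

lemma bilinear_map_pure_tensor: "bilinear_map K V W (tensor K V W) (pure_tensor K V W)"
proof (intro bilinear_mapI linear_mapI V W vectorspace_tensor pure_tensor_closed; assumption?)
  fix x y y' assume *: "x \<in> carrier V" "y \<in> carrier W" "y' \<in> carrier W"
  then have "N +>\<^bsub>F\<^esub> e x (y \<oplus>\<^bsub>W\<^esub> y') = N +>\<^bsub>F\<^esub> (e x y \<oplus>\<^bsub>F\<^esub> e x y')"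
    by (intro relation_coset) (auto simp: tensor_relations_def Let_def intro!: tensor_gen_closed F.a_closed)
  then show "pure_tensor K V W x (y \<oplus>\<^bsub>W\<^esub> y')
      = pure_tensor K V W x y \<oplus>\<^bsub>tensor K V W\<^esub> pure_tensor K V W x y'"
    unfolding pure_tensor_def using * by (simp add: C.T_add tensor_gen_closed)
next
  fix x c y assume *: "x \<in> carrier V" "c \<in> carrier K" "y \<in> carrier W"
  then have "N +>\<^bsub>F\<^esub> e x (c \<odot>\<^bsub>W\<^esub> y) = N +>\<^bsub>F\<^esub> (c \<odot>\<^bsub>F\<^esub> e x y)"
    by (intro relation_coset) (auto simp: tensor_relations_def Let_def intro!: tensor_gen_closed F.smult_closed)
  then show "pure_tensor K V W x (c \<odot>\<^bsub>W\<^esub> y) = c \<odot>\<^bsub>tensor K V W\<^esub> pure_tensor K V W x y"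
    unfolding pure_tensor_def using * by (simp add: C.T_smult tensor_gen_closed)
next
  fix y x x' assume *: "y \<in> carrier W" "x \<in> carrier V" "x' \<in> carrier V"
  then have "N +>\<^bsub>F\<^esub> e (x \<oplus>\<^bsub>V\<^esub> x') y = N +>\<^bsub>F\<^esub> (e x y \<oplus>\<^bsub>F\<^esub> e x' y)"
    by (intro relation_coset) (auto simp: tensor_relations_def Let_def intro!: tensor_gen_closed F.a_closed)
  then show "pure_tensor K V W (x \<oplus>\<^bsub>V\<^esub> x') y
      = pure_tensor K V W x y \<oplus>\<^bsub>tensor K V W\<^esub> pure_tensor K V W x' y"
    unfolding pure_tensor_def using * by (simp add: C.T_add tensor_gen_closed)
next
  fix y c x assume *: "y \<in> carrier W" "c \<in> carrier K" "x \<in> carrier V"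
  then have "N +>\<^bsub>F\<^esub> e (c \<odot>\<^bsub>V\<^esub> x) y = N +>\<^bsub>F\<^esub> (c \<odot>\<^bsub>F\<^esub> e x y)"
    by (intro relation_coset) (auto simp: tensor_relations_def Let_def intro!: tensor_gen_closed F.smult_closed)
  then show "pure_tensor K V W (c \<odot>\<^bsub>V\<^esub> x) y = c \<odot>\<^bsub>tensor K V W\<^esub> pure_tensor K V W x y"
    unfolding pure_tensor_def using * by (simp add: C.T_smult tensor_gen_closed)
qed

text \<open>
  Pure tensors are the classes of the free generators, so this is the corresponding fact on
  the free space, transported along the projection. Every identity between maps on tensor
  products below is proved by this lemma or its three-factor version.
\<close>
lemma tensor_linear_map_eq:
  assumes g: "linear_map K (tensor K V W) P g" and h: "linear_map K (tensor K V W) P h"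
    and pure: "\<And>x y. \<lbrakk>x \<in> carrier V; y \<in> carrier W\<rbrakk> \<Longrightarrow>
      g (pure_tensor K V W x y) = h (pure_tensor K V W x y)"
    and t: "t \<in> carrier (tensor K V W)"
  shows "g t = h t"
proof -
  obtain f where f: "f \<in> carrier F" "t = N +>\<^bsub>F\<^esub> f"
    using t by (rule tensor_cosetE)
  have "g (N +>\<^bsub>F\<^esub> f) = h (N +>\<^bsub>F\<^esub> f)"
  proof (rule V.free_space_linear_map_eq[where F = "\<lambda>f. g (N +>\<^bsub>F\<^esub> f)" and G = "\<lambda>f. h (N +>\<^bsub>F\<^esub> f)"])
    show "linear_map K (free_space K (carrier V \<times> carrier W)) P (\<lambda>f. g (N +>\<^bsub>F\<^esub> f))"
      using linear_map_comp[OF linear_map_tensor_coset g] by (simp only: tensor_free_def)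
    show "linear_map K (free_space K (carrier V \<times> carrier W)) P (\<lambda>f. h (N +>\<^bsub>F\<^esub> f))"
      using linear_map_comp[OF linear_map_tensor_coset h] by (simp only: tensor_free_def)
    show "f \<in> carrier (free_space K (carrier V \<times> carrier W))"
      using f(1) by (simp only: tensor_free_def)
  next
    fix p assume "p \<in> carrier V \<times> carrier W"
    then show "g (N +>\<^bsub>F\<^esub> free_gen K (carrier V \<times> carrier W) p)
        = h (N +>\<^bsub>F\<^esub> free_gen K (carrier V \<times> carrier W) p)"
      using pure[of "fst p" "snd p"] by (auto simp: pure_tensor_def tensor_gen_def)
  qed
  then show ?thesis by (simp only: f(2))
qed

context
  fixes P :: "('k, 'p, 'r) module_scheme" and b :: "'v \<Rightarrow> 'w \<Rightarrow> 'p"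
  assumes P: "vectorspace K P" and b: "bilinear_map K V W P b"
begin

interpretation P: vectorspace K P by (rule P)

private abbreviation "b_ext \<equiv> V.free_extend (carrier V \<times> carrier W) P (\<lambda>p. b (fst p) (snd p))"

lemma bilinear_map_closed: "\<lbrakk>x \<in> carrier V; y \<in> carrier W\<rbrakk> \<Longrightarrow> b x y \<in> carrier P"
  using linear_map.T_im[OF bilinear_mapD(1)[OF b]] .

lemma linear_map_bilinear_extension: "linear_map K F P b_ext"
  unfolding tensor_free_def by (rule V.linear_map_free_extend[OF P]) (auto intro: bilinear_map_closed)

lemma bilinear_extension_gen: "\<lbrakk>x \<in> carrier V; y \<in> carrier W\<rbrakk> \<Longrightarrow> b_ext (e x y) = b x y"
  unfolding tensor_gen_def by (subst V.free_extend_gen[OF P]) (auto intro: bilinear_map_closed)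

interpretation B: linear_map K F P b_ext by (rule linear_map_bilinear_extension)

text \<open>
  The linear extension of a bilinear map kills each relation, hence their span. This is what
  makes \<open>tensor_lift\<close> independent of the representative it chooses.
\<close>
lemma bilinear_extension_null:
  assumes "f \<in> N" shows "b_ext f = \<zero>\<^bsub>P\<^esub>"
proof -
  have "tensor_relations K V W \<subseteq> B.ker"
    using bilinear_map_closed linear_map.T_add[OF bilinear_mapD(1)[OF b]] linear_map.T_add[OF bilinear_mapD(2)[OF b]]
      linear_map.T_smult[OF bilinear_mapD(1)[OF b]] linear_map.T_smult[OF bilinear_mapD(2)[OF b]]
    by (auto simp: tensor_relations_def Let_def B.ker_def tensor_gen_closed B.T_minus B.T_add B.T_smult bilinear_extension_gen)
  then have "N \<subseteq> B.ker"
    unfolding tensor_null_def by (rule F.span_is_subset) (rule B.ker_is_submodule)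
  then show ?thesis
    using assms by (auto simp: B.ker_def)
qed

lemma tensor_lift_coset:
  assumes f: "f \<in> carrier F"
  shows "tensor_lift K V W P b (N +>\<^bsub>F\<^esub> f) = b_ext f"
proof -
  interpret S: abelian_subgroup N F
    by (rule abelian_subgroup_submodule[OF vectorspace_tensor_free submodule_tensor_null])
  define g where "g = (SOME g. g \<in> N +>\<^bsub>F\<^esub> f)"
  have g: "g \<in> N +>\<^bsub>F\<^esub> f"
    unfolding g_def using S.a_rcos_self[OF f] by (rule someI[of "\<lambda>g. g \<in> N +>\<^bsub>F\<^esub> f"])
  then have gF: "g \<in> carrier F"
    by (rule S.a_elemrcos_carrier[OF f])
  have "g \<ominus>\<^bsub>F\<^esub> f \<in> N"
    unfolding a_minus_def using S.a_rcos_module_imp[OF f g] .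
  then have "b_ext (g \<ominus>\<^bsub>F\<^esub> f) = \<zero>\<^bsub>P\<^esub>"
    by (rule bilinear_extension_null)
  then have "b_ext g \<ominus>\<^bsub>P\<^esub> b_ext f = \<zero>\<^bsub>P\<^esub>"
    using B.T_minus[OF gF f] by simp
  then have "b_ext g = b_ext f"
    using B.T_im[OF gF] B.T_im[OF f] by simp
  then show ?thesis
    by (simp add: tensor_lift_def Let_def V.free_extend_def g_def)
qed

lemma linear_map_tensor_lift: "linear_map K (tensor K V W) P (tensor_lift K V W P b)"
proof (rule linear_mapI[OF vectorspace_tensor P])
  fix t assume "t \<in> carrier (tensor K V W)"
  then obtain f where f: "f \<in> carrier F" "t = N +>\<^bsub>F\<^esub> f" by (rule tensor_cosetE)
  show "tensor_lift K V W P b t \<in> carrier P"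
    unfolding f(2) tensor_lift_coset[OF f(1)] by (rule B.T_im[OF f(1)])
next
  fix s t assume "s \<in> carrier (tensor K V W)" "t \<in> carrier (tensor K V W)"
  then obtain f g where f: "f \<in> carrier F" "s = N +>\<^bsub>F\<^esub> f" and g: "g \<in> carrier F" "t = N +>\<^bsub>F\<^esub> g"
    by (metis tensor_cosetE)
  have "s \<oplus>\<^bsub>tensor K V W\<^esub> t = N +>\<^bsub>F\<^esub> (f \<oplus>\<^bsub>F\<^esub> g)"
    unfolding f(2) g(2) by (rule C.T_add[OF f(1) g(1), symmetric])
  then show "tensor_lift K V W P b (s \<oplus>\<^bsub>tensor K V W\<^esub> t)
      = tensor_lift K V W P b s \<oplus>\<^bsub>P\<^esub> tensor_lift K V W P b t"
    by (simp only: f(2) g(2) tensor_lift_coset f(1) g(1) F.a_closed B.T_add)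
next
  fix c t assume c: "c \<in> carrier K" and "t \<in> carrier (tensor K V W)"
  then obtain f where f: "f \<in> carrier F" "t = N +>\<^bsub>F\<^esub> f" by (metis tensor_cosetE)
  have "c \<odot>\<^bsub>tensor K V W\<^esub> t = N +>\<^bsub>F\<^esub> (c \<odot>\<^bsub>F\<^esub> f)"
    unfolding f(2) by (rule C.T_smult[OF c f(1), symmetric])
  then show "tensor_lift K V W P b (c \<odot>\<^bsub>tensor K V W\<^esub> t) = c \<odot>\<^bsub>P\<^esub> tensor_lift K V W P b t"
    by (simp only: f(2) tensor_lift_coset f(1) c F.smult_closed B.T_smult)
qed

lemma tensor_lift_pure:
  "\<lbrakk>x \<in> carrier V; y \<in> carrier W\<rbrakk> \<Longrightarrow> tensor_lift K V W P b (pure_tensor K V W x y) = b x y"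
  by (simp add: pure_tensor_def tensor_lift_coset tensor_gen_closed bilinear_extension_gen)

end

end

section \<open>Tensor products of linear maps, flip and reassociation\<close>

lemma linear_map_pure_tensor:
  assumes "vectorspace K V" "vectorspace K W"
  shows "x \<in> carrier V \<Longrightarrow> linear_map K W (tensor K V W) (pure_tensor K V W x)"
    and "y \<in> carrier W \<Longrightarrow> linear_map K V (tensor K V W) (\<lambda>x. pure_tensor K V W x y)"
  using bilinear_mapD[OF bilinear_map_pure_tensor[OF assms]] by blast+

lemma
  assumes f: "linear_map K V V' f" and g: "linear_map K W W' g"
  shows linear_map_tensor_map: "linear_map K (tensor K V W) (tensor K V' W') (tensor_map K V W V' W' f g)"
    and tensor_map_pure [simp]: "\<lbrakk>x \<in> carrier V; y \<in> carrier W\<rbrakk> \<Longrightarrow>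
      tensor_map K V W V' W' f g (pure_tensor K V W x y) = pure_tensor K V' W' (f x) (g y)"
proof -
  note vs = linear_map_domain[OF f] linear_map_domain[OF g] linear_map_codomain[OF f] linear_map_codomain[OF g]
  have b: "bilinear_map K V W (tensor K V' W') (\<lambda>x y. pure_tensor K V' W' (f x) (g y))"
  proof (rule bilinear_mapI)
    fix x assume "x \<in> carrier V"
    then show "linear_map K W (tensor K V' W') (\<lambda>y. pure_tensor K V' W' (f x) (g y))"
      by (intro linear_map_comp[OF g] linear_map_pure_tensor(1) vs linear_map.T_im[OF f])
  next
    fix y assume "y \<in> carrier W"
    then show "linear_map K V (tensor K V' W') (\<lambda>x. pure_tensor K V' W' (f x) (g y))"
      by (intro linear_map_comp[OF f linear_map_pure_tensor(2)] vs linear_map.T_im[OF g])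
  qed
  show "linear_map K (tensor K V W) (tensor K V' W') (tensor_map K V W V' W' f g)"
    unfolding tensor_map_def by (intro linear_map_tensor_lift vs vectorspace_tensor b)
  show "tensor_map K V W V' W' f g (pure_tensor K V W x y) = pure_tensor K V' W' (f x) (g y)"
    if "x \<in> carrier V" "y \<in> carrier W"
    unfolding tensor_map_def using that by (intro tensor_lift_pure[OF _ _ _ b] vs vectorspace_tensor)
qed

lemma
  assumes V: "vectorspace K V" and W: "vectorspace K W"
  shows linear_map_tensor_flip: "linear_map K (tensor K V W) (tensor K W V) (tensor_flip K V W)"
    and tensor_flip_pure [simp]: "\<lbrakk>x \<in> carrier V; y \<in> carrier W\<rbrakk> \<Longrightarrow>
      tensor_flip K V W (pure_tensor K V W x y) = pure_tensor K W V y x"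
proof -
  have b: "bilinear_map K V W (tensor K W V) (\<lambda>x y. pure_tensor K W V y x)"
    by (intro bilinear_mapI linear_map_pure_tensor V W)
  show "linear_map K (tensor K V W) (tensor K W V) (tensor_flip K V W)"
    unfolding tensor_flip_def by (intro linear_map_tensor_lift V W vectorspace_tensor b)
  show "tensor_flip K V W (pure_tensor K V W x y) = pure_tensor K W V y x"
    if "x \<in> carrier V" "y \<in> carrier W"
    unfolding tensor_flip_def using that by (intro tensor_lift_pure[OF _ _ _ b] V W vectorspace_tensor)
qed

text \<open>
  Reassociation is defined by two nested lifts. The inner lift is linear in its tensor argument;
  its linearity in the outer vector \<open>x\<close> is an identity between linear maps of the tensor argument
  and can therefore be checked on pure tensors.
\<close>
lemma
  assumes U: "vectorspace K U" and V: "vectorspace K V" and W: "vectorspace K W"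
  shows linear_map_tensor_assoc:
      "linear_map K (tensor K U (tensor K V W)) (tensor K (tensor K U V) W) (tensor_assoc K U V W)"
    and tensor_assoc_pure [simp]: "\<lbrakk>x \<in> carrier U; y \<in> carrier V; z \<in> carrier W\<rbrakk> \<Longrightarrow>
      tensor_assoc K U V W (pure_tensor K U (tensor K V W) x (pure_tensor K V W y z))
        = pure_tensor K (tensor K U V) W (pure_tensor K U V x y) z"
proof -
  let ?T = "tensor K (tensor K U V) W"
  let ?p = "\<lambda>x y z. pure_tensor K (tensor K U V) W (pure_tensor K U V x y) z"
  note vs = U V W vectorspace_tensor[OF U V] vectorspace_tensor[OF V W]
    vectorspace_tensor[OF vectorspace_tensor[OF U V] W]
  have p: "bilinear_map K V W ?T (?p x)" if x: "x \<in> carrier U" for x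
  proof (rule bilinear_mapI)
    fix y assume "y \<in> carrier V"
    then show "linear_map K W ?T (?p x y)"
      by (intro linear_map_pure_tensor(1) vs pure_tensor_closed x)
  next
    fix z assume "z \<in> carrier W"
    then show "linear_map K V ?T (\<lambda>y. ?p x y z)"
      by (intro linear_map_comp[OF linear_map_pure_tensor(1)[OF U V x] linear_map_pure_tensor(2)] vs)
  qed
  have p1: "linear_map K U ?T (\<lambda>x. ?p x y z)" if "y \<in> carrier V" "z \<in> carrier W" for y z
    using that by (intro linear_map_comp[OF linear_map_pure_tensor(2) linear_map_pure_tensor(2)] vs)
  let ?l = "\<lambda>x. tensor_lift K V W ?T (?p x)"
  have l: "linear_map K (tensor K V W) ?T (?l x)" if "x \<in> carrier U" for x
    by (intro linear_map_tensor_lift vs p that)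
  have l_pure: "?l x (pure_tensor K V W y z) = ?p x y z"
    if "x \<in> carrier U" "y \<in> carrier V" "z \<in> carrier W" for x y z
    using that by (intro tensor_lift_pure vs p)
  interpret U: vectorspace K U by (rule U)
  have b: "bilinear_map K U (tensor K V W) ?T ?l"
  proof (rule bilinear_mapI)
    fix t assume t: "t \<in> carrier (tensor K V W)"
    show "linear_map K U ?T (\<lambda>x. ?l x t)"
    proof (rule linear_mapI)
      fix x assume "x \<in> carrier U"
      then show "?l x t \<in> carrier ?T"
        by (intro linear_map.T_im[OF l] t)
    next
      fix x x' assume x: "x \<in> carrier U" "x' \<in> carrier U"
      show "?l (x \<oplus>\<^bsub>U\<^esub> x') t = ?l x t \<oplus>\<^bsub>?T\<^esub> ?l x' t"
      proof (rule tensor_linear_map_eq[OF V W _ _ _ t])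
        show "linear_map K (tensor K V W) ?T (?l (x \<oplus>\<^bsub>U\<^esub> x'))"
          using x by (intro l) simp
        show "linear_map K (tensor K V W) ?T (\<lambda>t. ?l x t \<oplus>\<^bsub>?T\<^esub> ?l x' t)"
          using x by (intro linear_map_add l)
      next
        fix y z assume "y \<in> carrier V" "z \<in> carrier W"
        then show "?l (x \<oplus>\<^bsub>U\<^esub> x') (pure_tensor K V W y z)
            = ?l x (pure_tensor K V W y z) \<oplus>\<^bsub>?T\<^esub> ?l x' (pure_tensor K V W y z)"
          using x by (simp add: l_pure linear_map.T_add[OF p1])
      qed
    next
      fix c x assume x: "c \<in> carrier K" "x \<in> carrier U"
      show "?l (c \<odot>\<^bsub>U\<^esub> x) t = c \<odot>\<^bsub>?T\<^esub> ?l x t"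
      proof (rule tensor_linear_map_eq[OF V W _ _ _ t])
        show "linear_map K (tensor K V W) ?T (?l (c \<odot>\<^bsub>U\<^esub> x))"
          using x by (intro l) simp
        show "linear_map K (tensor K V W) ?T (\<lambda>t. c \<odot>\<^bsub>?T\<^esub> ?l x t)"
          using x by (intro linear_map_scale l)
      next
        fix y z assume "y \<in> carrier V" "z \<in> carrier W"
        then show "?l (c \<odot>\<^bsub>U\<^esub> x) (pure_tensor K V W y z) = c \<odot>\<^bsub>?T\<^esub> ?l x (pure_tensor K V W y z)"
          using x by (simp add: l_pure linear_map.T_smult[OF p1])
      qed
    qed (rule vs)+
  qed (rule l)
  show "linear_map K (tensor K U (tensor K V W)) ?T (tensor_assoc K U V W)"
    unfolding tensor_assoc_def by (intro linear_map_tensor_lift vs b)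
  show "tensor_assoc K U V W (pure_tensor K U (tensor K V W) x (pure_tensor K V W y z)) = ?p x y z"
    if "x \<in> carrier U" "y \<in> carrier V" "z \<in> carrier W"
    unfolding tensor_assoc_def
    using that by (subst tensor_lift_pure[OF _ _ _ b]) (simp_all add: vs l_pure)
qed

text \<open>
  For a fixed first vector \<open>x\<close> both sides are linear in the second factor, which lies in a tensor
  product itself, so the two-factor criterion applies twice.
\<close>
lemma tensor3_linear_map_eq:
  assumes vs: "vectorspace K U" "vectorspace K V" "vectorspace K W"
    and g: "linear_map K (tensor K U (tensor K V W)) P g"
    and h: "linear_map K (tensor K U (tensor K V W)) P h"
    and pure: "\<And>x y z. \<lbrakk>x \<in> carrier U; y \<in> carrier V; z \<in> carrier W\<rbrakk> \<Longrightarrow>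
      g (pure_tensor K U (tensor K V W) x (pure_tensor K V W y z))
        = h (pure_tensor K U (tensor K V W) x (pure_tensor K V W y z))"
    and t: "t \<in> carrier (tensor K U (tensor K V W))"
  shows "g t = h t"
proof (rule tensor_linear_map_eq[OF vs(1) vectorspace_tensor[OF vs(2,3)] g h _ t])
  fix x s assume x: "x \<in> carrier U" and s: "s \<in> carrier (tensor K V W)"
  note x_pure = linear_map_pure_tensor(1)[OF vs(1) vectorspace_tensor[OF vs(2,3)] x]
  show "g (pure_tensor K U (tensor K V W) x s) = h (pure_tensor K U (tensor K V W) x s)"
    by (rule tensor_linear_map_eq[OF vs(2,3) linear_map_comp[OF x_pure g] linear_map_comp[OF x_pure h] _ s])
      (rule pure[OF x])
qed

lemma tensor_map_comp:
  assumes f: "linear_map K V V' f" "linear_map K V' V'' f'"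
    and g: "linear_map K W W' g" "linear_map K W' W'' g'"
    and t: "t \<in> carrier (tensor K V W)"
  shows "tensor_map K V' W' V'' W'' f' g' (tensor_map K V W V' W' f g t)
    = tensor_map K V W V'' W'' (\<lambda>x. f' (f x)) (\<lambda>y. g' (g y)) t"
proof -
  note fg = linear_map_comp[OF f] linear_map_comp[OF g]
  show ?thesis
    by (rule tensor_linear_map_eq[OF linear_map_domain[OF f(1)] linear_map_domain[OF g(1)]
          linear_map_comp[OF linear_map_tensor_map[OF f(1) g(1)] linear_map_tensor_map[OF f(2) g(2)]]
          linear_map_tensor_map[OF fg] _ t])
       (simp add: f g fg linear_map.T_im[OF f(1)] linear_map.T_im[OF g(1)])
qed

lemma tensor_map_cong:
  assumes f: "linear_map K V V' f" "linear_map K V V' f'"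
    and g: "linear_map K W W' g" "linear_map K W W' g'"
    and eq: "\<And>x. x \<in> carrier V \<Longrightarrow> f x = f' x" "\<And>y. y \<in> carrier W \<Longrightarrow> g y = g' y"
    and t: "t \<in> carrier (tensor K V W)"
  shows "tensor_map K V W V' W' f g t = tensor_map K V W V' W' f' g' t"
  by (rule tensor_linear_map_eq[OF linear_map_domain[OF f(1)] linear_map_domain[OF g(1)]
        linear_map_tensor_map[OF f(1) g(1)] linear_map_tensor_map[OF f(2) g(2)] _ t])
     (simp add: f g eq)

lemma tensor_map_id:
  assumes vs: "vectorspace K V" "vectorspace K W" and t: "t \<in> carrier (tensor K V W)"
  shows "tensor_map K V W V W (\<lambda>x. x) (\<lambda>y. y) t = t"
  by (rule tensor_linear_map_eq[OF vs linear_map_tensor_map linear_map_id _ t])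
     (simp_all add: vs linear_map_id vectorspace_tensor)

lemma tensor_map_minus_left:
  assumes f: "linear_map K V V' f" "linear_map K V V' f'" and g: "linear_map K W W' g"
    and t: "t \<in> carrier (tensor K V W)"
  shows "tensor_map K V W V' W' (\<lambda>x. f x \<ominus>\<^bsub>V'\<^esub> f' x) g t
    = tensor_map K V W V' W' f g t \<ominus>\<^bsub>tensor K V' W'\<^esub> tensor_map K V W V' W' f' g t"
  by (rule tensor_linear_map_eq[OF linear_map_domain[OF f(1)] linear_map_domain[OF g]
        linear_map_tensor_map[OF linear_map_minus[OF f] g]
        linear_map_minus[OF linear_map_tensor_map[OF f(1) g] linear_map_tensor_map[OF f(2) g]] _ t])
     (simp add: f g linear_map_minus linear_map.T_im[OF f(1)] linear_map.T_im[OF f(2)] linear_map.T_im[OF g]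
       linear_map.T_minus[OF linear_map_pure_tensor(2)[OF linear_map_codomain[OF f(1)] linear_map_codomain[OF g]]])

lemma tensor_map_minus_right:
  assumes f: "linear_map K V V' f" and g: "linear_map K W W' g" "linear_map K W W' g'"
    and t: "t \<in> carrier (tensor K V W)"
  shows "tensor_map K V W V' W' f (\<lambda>y. g y \<ominus>\<^bsub>W'\<^esub> g' y) t
    = tensor_map K V W V' W' f g t \<ominus>\<^bsub>tensor K V' W'\<^esub> tensor_map K V W V' W' f g' t"
  by (rule tensor_linear_map_eq[OF linear_map_domain[OF f] linear_map_domain[OF g(1)]
        linear_map_tensor_map[OF f linear_map_minus[OF g]]
        linear_map_minus[OF linear_map_tensor_map[OF f g(1)] linear_map_tensor_map[OF f g(2)]] _ t])
     (simp add: f g linear_map_minus linear_map.T_im[OF f] linear_map.T_im[OF g(1)] linear_map.T_im[OF g(2)]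
       linear_map.T_minus[OF linear_map_pure_tensor(1)[OF linear_map_codomain[OF f] linear_map_codomain[OF g(1)]]])

lemma tensor_flip_map:
  assumes f: "linear_map K V V' f" and g: "linear_map K W W' g"
    and t: "t \<in> carrier (tensor K V W)"
  shows "tensor_flip K V' W' (tensor_map K V W V' W' f g t)
    = tensor_map K W V W' V' g f (tensor_flip K V W t)"
proof -
  note vs = linear_map_domain[OF f] linear_map_domain[OF g] linear_map_codomain[OF f] linear_map_codomain[OF g]
  show ?thesis
    by (rule tensor_linear_map_eq[OF vs(1,2)
          linear_map_comp[OF linear_map_tensor_map[OF f g] linear_map_tensor_flip[OF vs(3,4)]]
          linear_map_comp[OF linear_map_tensor_flip[OF vs(1,2)] linear_map_tensor_map[OF g f]] _ t])
       (simp add: vs f g linear_map.T_im[OF f] linear_map.T_im[OF g])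
qed

lemma tensor_flip_flip:
  assumes V: "vectorspace K V" and W: "vectorspace K W" and t: "t \<in> carrier (tensor K V W)"
  shows "tensor_flip K W V (tensor_flip K V W t) = t"
  by (rule tensor_linear_map_eq[OF V W
        linear_map_comp[OF linear_map_tensor_flip[OF V W] linear_map_tensor_flip[OF W V]]
        linear_map_id[OF vectorspace_tensor[OF V W]] _ t])
     (simp add: V W)

lemma tensor_assoc_map:
  assumes f: "linear_map K U U' f" and g: "linear_map K V V' g" and h: "linear_map K W W' h"
    and t: "t \<in> carrier (tensor K U (tensor K V W))"
  shows "tensor_assoc K U' V' W'
      (tensor_map K U (tensor K V W) U' (tensor K V' W') f (tensor_map K V W V' W' g h) t)
    = tensor_map K (tensor K U V) W (tensor K U' V') W' (tensor_map K U V U' V' f g) h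
        (tensor_assoc K U V W t)"
proof -
  note vs = linear_map_domain[OF f] linear_map_domain[OF g] linear_map_domain[OF h]
  note vs' = linear_map_codomain[OF f] linear_map_codomain[OF g] linear_map_codomain[OF h]
  note lin = linear_map_tensor_map[OF g h] linear_map_tensor_map[OF f g]
  show ?thesis
    by (rule tensor3_linear_map_eq[OF vs
          linear_map_comp[OF linear_map_tensor_map[OF f lin(1)] linear_map_tensor_assoc[OF vs']]
          linear_map_comp[OF linear_map_tensor_assoc[OF vs] linear_map_tensor_map[OF lin(2) h]] _ t])
       (simp add: f g h lin vs vs' linear_map.T_im[OF f] linear_map.T_im[OF g] linear_map.T_im[OF h])
qed

section \<open>Differences in abelian groups\<close>

context abelian_group
begin

lemma minus_minus_swap:
  assumes "a \<in> carrier G" "b \<in> carrier G" "c \<in> carrier G" "d \<in> carrier G"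
  shows "(a \<ominus> b) \<ominus> (c \<ominus> d) = (a \<oplus> d) \<ominus> (b \<oplus> c)"
  using assms by (simp add: a_minus_def minus_add a_ac)

lemma minus_eq_minus_iff:
  assumes cl: "a \<in> carrier G" "b \<in> carrier G" "c \<in> carrier G" "d \<in> carrier G"
  shows "a \<ominus> b = c \<ominus> d \<longleftrightarrow> a \<oplus> d = c \<oplus> b"
proof -
  have cancel: "(x \<ominus> y) \<oplus> (y \<oplus> z) = x \<oplus> z"
    if "x \<in> carrier G" "y \<in> carrier G" "z \<in> carrier G" for x y z
    using that by (simp add: a_minus_def a_assoc r_neg1)
  have "a \<ominus> b = c \<ominus> d \<longleftrightarrow> (a \<ominus> b) \<oplus> (b \<oplus> d) = (c \<ominus> d) \<oplus> (b \<oplus> d)"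
    using cl by (simp add: minus_closed)
  also have "\<dots> \<longleftrightarrow> a \<oplus> d = c \<oplus> b"
    using cl cancel[of a b d] cancel[of c d b] by (simp only: a_comm[of b d])
  finally show ?thesis .
qed

text \<open>
  The bookkeeping behind the co-Jacobi identity: the letters stand for the six permutations of
  one threefold tensor, and the terms \<open>c\<close> and \<open>d\<close>, which both occur twice with opposite signs,
  disappear.
\<close>
lemma co_jacobi_cancellation:
  assumes cl: "a \<in> carrier G" "b \<in> carrier G" "c \<in> carrier G" "d \<in> carrier G" "e \<in> carrier G" "f \<in> carrier G"
  shows "((a \<ominus> d) \<ominus> (c \<ominus> f)) \<ominus> ((b \<ominus> c) \<ominus> (d \<ominus> e)) = (a \<ominus> b) \<ominus> (e \<ominus> f)"
  using cl by (simp add: minus_minus_swap minus_eq_minus_iff a_ac)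

end

section \<open>Permuting three tensor factors\<close>

text \<open>
  The cyclic permutation \<open>(x \<otimes> y) \<otimes> z \<mapsto> (z \<otimes> x) \<otimes> y\<close>. Together with \<open>\<tau>\<^sup>1\<^sup>2\<close> it generates all
  permutations of three factors, and being a flip followed by a reassociation it is exactly
  what separates \<open>\<alpha> \<otimes> D\<close> after a flip from \<open>D \<otimes> \<alpha>\<close>.
\<close>
definition tensor_rotate ::
  "('k, 'q) ring_scheme \<Rightarrow> ('k, 'a, 'm) module_scheme
    \<Rightarrow> (('a \<times> 'a \<Rightarrow> 'k) set \<times> 'a \<Rightarrow> 'k) set \<Rightarrow> (('a \<times> 'a \<Rightarrow> 'k) set \<times> 'a \<Rightarrow> 'k) set" where
  "tensor_rotate K L t = tensor_assoc K L L L (tensor_flip K (tensor K L L) L t)"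

context vectorspace_char_0
begin

abbreviation rotate3 where "rotate3 \<equiv> tensor_rotate K L"

lemma vectorspace_L2: "vectorspace K L2"
  by (intro vectorspace_tensor vectorspace_axioms)

lemma vectorspace_L3: "vectorspace K L3"
  by (intro vectorspace_tensor vectorspace_axioms)

lemma linear_map_tau: "linear_map K L2 L2 tau"
  by (rule linear_map_tensor_flip[OF vectorspace_axioms vectorspace_axioms])

lemma tau_tau: "t \<in> carrier L2 \<Longrightarrow> tau (tau t) = t"
  by (rule tensor_flip_flip[OF vectorspace_axioms vectorspace_axioms])

lemma linear_map_tau12: "linear_map K L3 L3 tau12"
  by (rule linear_map_tensor_map[OF linear_map_tau linear_map_id[OF vectorspace_axioms]])

lemma linear_map_assoc: "linear_map K (tensor K L L2) L3 (tensor_assoc K L L L)"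
  by (rule linear_map_tensor_assoc[OF vectorspace_axioms vectorspace_axioms vectorspace_axioms])

lemma linear_map_rotate3: "linear_map K L3 L3 rotate3"
  unfolding tensor_rotate_def
  by (rule linear_map_comp[OF linear_map_tensor_flip[OF vectorspace_L2 vectorspace_axioms] linear_map_assoc])

lemma tau12_tau12:
  assumes t: "t \<in> carrier L3"
  shows "tau12 (tau12 t) = t"
proof -
  note id = linear_map_id[OF vectorspace_axioms] linear_map_id[OF vectorspace_L2]
  have "tau12 (tau12 t) = tensor_map K L2 L L2 L (\<lambda>s. tau (tau s)) (\<lambda>z. z) t"
    by (rule tensor_map_comp[OF linear_map_tau linear_map_tau id(1) id(1) t])
  also have "\<dots> = tensor_map K L2 L L2 L (\<lambda>s. s) (\<lambda>z. z) t"
    by (rule tensor_map_cong[OF linear_map_comp[OF linear_map_tau linear_map_tau] id(2) id(1) id(1) tau_tau refl t])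
  also have "\<dots> = t"
    by (rule tensor_map_id[OF vectorspace_L2 vectorspace_axioms t])
  finally show ?thesis .
qed

lemma rotate3_pure:
  "\<lbrakk>x \<in> carrier L; y \<in> carrier L; z \<in> carrier L\<rbrakk> \<Longrightarrow>
    rotate3 (pure_tensor K L2 L (pure_tensor K L L x y) z) = pure_tensor K L2 L (pure_tensor K L L z x) y"
  by (simp add: tensor_rotate_def vectorspace_L2 vectorspace_axioms)

text \<open>
  Both maps send \<open>x \<otimes> (y \<otimes> z)\<close> to \<open>(y \<otimes> z) \<otimes> x\<close>.
\<close>
lemma flip_eq_rotate3:
  assumes t: "t \<in> carrier (tensor K L L2)"
  shows "tensor_flip K L L2 t = rotate3 (rotate3 (tensor_assoc K L L L t))"
  by (rule tensor3_linear_map_eq[OF vectorspace_axioms vectorspace_axioms vectorspace_axioms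
        linear_map_tensor_flip[OF vectorspace_axioms vectorspace_L2]
        linear_map_comp[OF linear_map_assoc linear_map_comp[OF linear_map_rotate3 linear_map_rotate3]] _ t])
     (simp add: vectorspace_axioms vectorspace_L2 rotate3_pure)

text \<open>
  Exchanging the last two of three factors, expressed by the chosen generators:
  \<open>x y z \<mapsto> z x y \<mapsto> x z y\<close>.
\<close>
lemma assoc_flip_right:
  assumes t: "t \<in> carrier (tensor K L L2)"
  shows "tensor_assoc K L L L (tensor_map K L L2 L L2 (\<lambda>x. x) tau t)
    = tau12 (rotate3 (tensor_assoc K L L L t))"
  by (rule tensor3_linear_map_eq[OF vectorspace_axioms vectorspace_axioms vectorspace_axioms
        linear_map_comp[OF linear_map_tensor_map[OF linear_map_id[OF vectorspace_axioms] linear_map_tau] linear_map_assoc]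
        linear_map_comp[OF linear_map_assoc linear_map_comp[OF linear_map_rotate3 linear_map_tau12]] _ t])
     (simp add: vectorspace_axioms vectorspace_L2 rotate3_pure linear_map_id linear_map_tau)

lemma linear_map_opposite: "linear_map K L L2 D \<Longrightarrow> linear_map K L L2 (\<lambda>l. tau (D l))"
  by (rule linear_map_comp[OF _ linear_map_tau])

text \<open>
  Everything obtained by flipping the inner or the outer coproduct in \<open>(D \<otimes> \<alpha>) t\<close> and
  \<open>(\<alpha> \<otimes> D) t\<close> is a permutation of these two elements, so \<open>\<tau>\<close> can always be moved out of the
  coproducts.
\<close>
context
  fixes D \<alpha>
  assumes D: "linear_map K L L2 D" and \<alpha>: "linear_map K L L \<alpha>"
begin

lemma coprod_right_closed: "t \<in> carrier L2 \<Longrightarrow> coprod_right \<alpha> D t \<in> carrier L3"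
  by (rule linear_map.T_im[OF linear_map_comp[OF linear_map_tensor_map[OF \<alpha> D] linear_map_assoc]])

lemma coprod_left_closed: "t \<in> carrier L2 \<Longrightarrow> coprod_left D \<alpha> t \<in> carrier L3"
  by (rule linear_map.T_im[OF linear_map_tensor_map[OF D \<alpha>]])

lemma coprod_right_tau:
  assumes t: "t \<in> carrier L2"
  shows "coprod_right \<alpha> D (tau t) = rotate3 (coprod_left D \<alpha> t)"
  by (simp add: tensor_rotate_def tensor_flip_map[OF D \<alpha> t])

lemma coprod_left_tau:
  assumes t: "t \<in> carrier L2"
  shows "coprod_left D \<alpha> (tau t) = rotate3 (rotate3 (coprod_right \<alpha> D t))"
  using flip_eq_rotate3[OF linear_map.T_im[OF linear_map_tensor_map[OF \<alpha> D] t]]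
  by (simp add: tensor_flip_map[OF \<alpha> D t])

lemma coprod_left_op:
  assumes t: "t \<in> carrier L2"
  shows "coprod_left (\<lambda>l. tau (D l)) \<alpha> t = tau12 (coprod_left D \<alpha> t)"
  by (rule tensor_map_comp[OF D linear_map_tau \<alpha> linear_map_id[OF vectorspace_axioms] t, symmetric])

lemma coprod_right_op:
  assumes t: "t \<in> carrier L2"
  shows "coprod_right \<alpha> (\<lambda>l. tau (D l)) t = tau12 (rotate3 (coprod_right \<alpha> D t))"
  using assoc_flip_right[OF linear_map.T_im[OF linear_map_tensor_map[OF \<alpha> D] t]]
  by (simp add: tensor_map_comp[OF \<alpha> linear_map_id[OF vectorspace_axioms] D linear_map_tau t])

end

end

section \<open>The antisymmetrised coproduct is a Hom-Lie cobracket\<close>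

context hom_coass_coder_pair
begin

definition cobracket where
  "cobracket l = \<Delta> l \<ominus>\<^bsub>L2\<^esub> tau (\<Delta> l)"

lemma linear_map_cobracket: "linear_map K L L2 cobracket"
  unfolding cobracket_def[abs_def]
  by (rule linear_map_minus[OF linear_Delta linear_map_comp[OF linear_Delta linear_map_tau]])

lemma coprod_left_cobracket:
  assumes t: "t \<in> carrier L2"
  shows "coprod_left cobracket \<alpha> t = coprod_left \<Delta> \<alpha> t \<ominus>\<^bsub>L3\<^esub> tau12 (coprod_left \<Delta> \<alpha> t)"
  unfolding cobracket_def[abs_def]
  using tensor_map_minus_left[OF linear_Delta linear_map_opposite[OF linear_Delta] linear_alpha t]
  by (simp only: coprod_left_op[OF linear_Delta linear_alpha t])

lemma coprod_right_cobracket: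
  assumes t: "t \<in> carrier L2"
  shows "coprod_right \<alpha> cobracket t
    = coprod_right \<alpha> \<Delta> t \<ominus>\<^bsub>L3\<^esub> tau12 (rotate3 (coprod_right \<alpha> \<Delta> t))"
  unfolding cobracket_def[abs_def]
    tensor_map_minus_right[OF linear_alpha linear_Delta linear_map_opposite[OF linear_Delta] t]
  using linear_map.T_minus[OF linear_map_assoc
      linear_map.T_im[OF linear_map_tensor_map[OF linear_alpha linear_Delta] t]
      linear_map.T_im[OF linear_map_tensor_map[OF linear_alpha linear_map_opposite[OF linear_Delta]] t]]
  by (simp only: coprod_right_op[OF linear_Delta linear_alpha t])

text \<open>
  Dual to the Jacobi identity in the form \<open>[\<alpha> a, [b, c]] - [\<alpha> b, [a, c]] = [[a, b], \<alpha> c]\<close>. Let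
  \<open>T = \<tau>\<^sup>1\<^sup>2\<close> and let \<open>\<rho>\<close> be the rotation. With the common value \<open>X\<close> of both sides of
  Hom-coassociativity, \<open>(\<alpha> \<otimes> \<Gamma>) \<Gamma> = X - T \<rho> X - \<rho> X + T \<rho>\<^sup>2 X\<close> and
  \<open>(\<Gamma> \<otimes> \<alpha>) \<Gamma> = X - T X - \<rho>\<^sup>2 X + T \<rho>\<^sup>2 X\<close>. Applying \<open>1 - T\<close> to the first sum
  yields the second, because \<open>T\<close> is an involution.
\<close>
lemma hom_co_jacobi:
  assumes l: "l \<in> carrier L"
  shows "coprod_right \<alpha> cobracket (cobracket l) \<ominus>\<^bsub>L3\<^esub> tau12 (coprod_right \<alpha> cobracket (cobracket l))
    = coprod_left cobracket \<alpha> (cobracket l)"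
proof -
  interpret L3: vectorspace K L3 by (rule vectorspace_L3)
  define X where "X = coprod_left \<Delta> \<alpha> (\<Delta> l)"
  note \<Delta>l = linear_map.T_im[OF linear_Delta l]
  note \<tau>\<Delta>l = linear_map.T_im[OF linear_map_tau \<Delta>l]
  have X: "X \<in> carrier L3"
    unfolding X_def by (rule coprod_left_closed[OF linear_Delta linear_alpha \<Delta>l])
  note T = linear_map.T_im[OF linear_map_tau12] and R = linear_map.T_im[OF linear_map_rotate3]
  note T_minus = linear_map.T_minus[OF linear_map_tau12]
  note cl = X R T
  have Xr: "coprod_right \<alpha> \<Delta> (\<Delta> l) = X"
    using hom_coass[OF l] by (simp add: X_def)
  have right: "coprod_right \<alpha> cobracket (cobracket l)
      = (X \<ominus>\<^bsub>L3\<^esub> tau12 (rotate3 X)) \<ominus>\<^bsub>L3\<^esub> (rotate3 X \<ominus>\<^bsub>L3\<^esub> tau12 (rotate3 (rotate3 X)))"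
    using linear_map.T_minus[OF linear_map_comp[OF linear_map_tensor_map[OF linear_alpha linear_map_cobracket]
          linear_map_assoc] \<Delta>l \<tau>\<Delta>l]
    by (simp only: cobracket_def[of l] coprod_right_cobracket \<Delta>l \<tau>\<Delta>l Xr
        coprod_right_tau[OF linear_Delta linear_alpha \<Delta>l] X_def[symmetric])
  have left: "coprod_left cobracket \<alpha> (cobracket l)
      = (X \<ominus>\<^bsub>L3\<^esub> tau12 X) \<ominus>\<^bsub>L3\<^esub> (rotate3 (rotate3 X) \<ominus>\<^bsub>L3\<^esub> tau12 (rotate3 (rotate3 X)))"
    using linear_map.T_minus[OF linear_map_tensor_map[OF linear_map_cobracket linear_alpha] \<Delta>l \<tau>\<Delta>l]
    by (simp only: cobracket_def[of l] coprod_left_cobracket \<Delta>l \<tau>\<Delta>l Xr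
        coprod_left_tau[OF linear_Delta linear_alpha \<Delta>l] X_def[symmetric])
  show ?thesis
    unfolding left right
    by (simp only: cl T_minus tau12_tau12 L3.minus_closed) (rule L3.co_jacobi_cancellation; intro cl)
qed

text \<open>
  The flip of \<open>(\<phi> \<otimes> \<alpha>) t\<close> is \<open>(\<alpha> \<otimes> \<phi>)\<close> applied to the flip of \<open>t\<close>, so the two summands of the
  coderivation rule for \<open>\<tau> \<circ> \<Delta>\<close> are those for \<open>\<Delta>\<close> in exchanged order.
\<close>
lemma cobracket_coder:
  assumes l: "l \<in> carrier L"
  shows "cobracket (\<phi> l) = tensor_endo \<phi> \<alpha> (cobracket l) \<oplus>\<^bsub>L2\<^esub> tensor_endo \<alpha> \<phi> (cobracket l)"
proof -
  interpret L2: vectorspace K L2 by (rule vectorspace_L2)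
  note \<Delta>l = linear_map.T_im[OF linear_Delta l]
  note \<tau> = linear_map.T_im[OF linear_map_tau]
  note \<phi>\<alpha> = linear_map_tensor_map[OF linear_phi linear_alpha]
  note \<alpha>\<phi> = linear_map_tensor_map[OF linear_alpha linear_phi]
  note cl = \<tau> \<Delta>l linear_map.T_im[OF \<phi>\<alpha>] linear_map.T_im[OF \<alpha>\<phi>]
  note flip = tensor_flip_map[OF linear_phi linear_alpha] tensor_flip_map[OF linear_alpha linear_phi]
  note lin = linear_map.T_minus[OF \<phi>\<alpha>] linear_map.T_minus[OF \<alpha>\<phi>] linear_map.T_add[OF linear_map_tau]
  show ?thesis
    by (simp add: cobracket_def coder[OF l] cl flip lin)
       (simp add: cl a_minus_def L2.minus_add L2.a_ac)
qed

end

section \<open>The pre-Lie coproduct of a Rota--Baxter operator\<close>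

context rota_baxter_hom_coass_coder_pair
begin

definition pre_lie_coproduct where
  "pre_lie_coproduct l = tensor_endo R (\<lambda>x. x) (cobracket l)"

lemma linear_id: "linear_map K L L (\<lambda>x. x)"
  by (rule linear_map_id[OF vectorspace_axioms])

lemma linear_map_pre_lie_coproduct: "linear_map K L L2 pre_lie_coproduct"
  unfolding pre_lie_coproduct_def[abs_def]
  by (rule linear_map_comp[OF linear_map_cobracket linear_map_tensor_map[OF linear_R linear_id]])

text \<open>
  Naturality of the flip: \<open>\<tau> \<circ> (1 \<otimes> R) = (R \<otimes> 1) \<circ> \<tau>\<close>.
\<close>
lemma pre_lie_coproduct_eq:
  assumes l: "l \<in> carrier L"
  shows "tensor_endo R (\<lambda>x. x) (\<Delta> l) \<ominus>\<^bsub>L2\<^esub> tau (tensor_endo (\<lambda>x. x) R (\<Delta> l)) = pre_lie_coproduct l"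
proof -
  note \<Delta>l = linear_map.T_im[OF linear_Delta l]
  show ?thesis
    unfolding pre_lie_coproduct_def cobracket_def
    by (simp only: tensor_flip_map[OF linear_id linear_R \<Delta>l] linear_map.T_im[OF linear_map_tau] \<Delta>l
        linear_map.T_minus[OF linear_map_tensor_map[OF linear_R linear_id]])
qed

text \<open>
  The dual of \<open>R ([R x, y] - [R y, x]) = [R x, R y]\<close>, the Rota--Baxter identity for the
  commutator bracket. With \<open>s = \<Delta> (R l)\<close>, both sides expand into the terms
  \<open>(R \<otimes> 1) s\<close>, \<open>(1 \<otimes> R) s\<close>, \<open>(R \<otimes> 1) (\<tau> s)\<close>, \<open>(1 \<otimes> R) (\<tau> s)\<close>, the first two with
  sign \<open>+\<close> and the others with sign \<open>-\<close>.
\<close>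
lemma commutator_pre_lie_coproduct_R:
  assumes w: "w = \<zero>\<^bsub>K\<^esub>" and l: "l \<in> carrier L"
  shows "pre_lie_coproduct (R l) \<ominus>\<^bsub>L2\<^esub> tau (pre_lie_coproduct (R l)) = tensor_endo R R (cobracket l)"
proof -
  interpret L2: vectorspace K L2 by (rule vectorspace_L2)
  define s where "s = \<Delta> (R l)"
  have s: "s \<in> carrier L2"
    unfolding s_def by (rule linear_map.T_im[OF linear_Delta linear_map.T_im[OF linear_R l]])
  note \<Delta>l = linear_map.T_im[OF linear_Delta l]
  note \<tau> = linear_map.T_im[OF linear_map_tau]
  note R1 = linear_map_tensor_map[OF linear_R linear_id]
  note R2 = linear_map_tensor_map[OF linear_id linear_R]
  note RR = linear_map_tensor_map[OF linear_R linear_R]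
  note cl = \<tau> s \<Delta>l linear_map.T_im[OF R1] linear_map.T_im[OF R2] linear_map.T_im[OF RR]
  note flip = tensor_flip_map[OF linear_R linear_id] tensor_flip_map[OF linear_id linear_R]
  note lin = linear_map.T_minus[OF R1] linear_map.T_minus[OF R2] linear_map.T_minus[OF RR]
    linear_map.T_add[OF linear_map_tau] linear_map.T_minus[OF linear_map_tau]
  have RB: "tensor_endo R R (\<Delta> l) = tensor_endo (\<lambda>x. x) R s \<oplus>\<^bsub>L2\<^esub> tensor_endo R (\<lambda>x. x) s"
    using rota_baxter[OF l] by (simp add: w s_def[symmetric] cl)
  have "tensor_endo R R (cobracket l) = tensor_endo R R (\<Delta> l) \<ominus>\<^bsub>L2\<^esub> tau (tensor_endo R R (\<Delta> l))"
    by (simp add: cobracket_def cl lin tensor_flip_map[OF linear_R linear_R])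
  also have "\<dots> = pre_lie_coproduct (R l) \<ominus>\<^bsub>L2\<^esub> tau (pre_lie_coproduct (R l))"
    unfolding RB pre_lie_coproduct_def cobracket_def s_def[symmetric]
    by (simp add: cl lin flip tau_tau)
       (simp add: cl a_minus_def L2.minus_add L2.a_ac)
  finally show ?thesis by simp
qed

text \<open>
  Here \<open>R\<close> from the outer \<open>P\<close> meets \<open>\<alpha>\<close> and is moved past it, while \<open>R\<close> from the inner \<open>P\<close> acts
  last anyway; together they form \<open>R \<otimes> R \<otimes> 1\<close>.
\<close>
lemma coprod_right_pre_lie:
  assumes l: "l \<in> carrier L"
  shows "coprod_right \<alpha> pre_lie_coproduct (pre_lie_coproduct l)
    = tensor_map K L2 L L2 L (tensor_endo R R) (\<lambda>z. z) (coprod_right \<alpha> cobracket (cobracket l))"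
proof -
  note \<Gamma>l = linear_map.T_im[OF linear_map_cobracket l]
  note R1 = linear_map_tensor_map[OF linear_R linear_id]
  have "tensor_map K L L L L2 \<alpha> pre_lie_coproduct (pre_lie_coproduct l)
      = tensor_map K L L L L2 (\<lambda>x. \<alpha> (R x)) (\<lambda>y. pre_lie_coproduct y) (cobracket l)"
    unfolding pre_lie_coproduct_def[of l]
    by (rule tensor_map_comp[OF linear_R linear_alpha linear_id linear_map_pre_lie_coproduct \<Gamma>l])
  also have "\<dots> = tensor_map K L L L L2 (\<lambda>x. R (\<alpha> x)) (\<lambda>y. tensor_endo R (\<lambda>x. x) (cobracket y)) (cobracket l)"
    by (intro tensor_map_cong[OF linear_map_comp[OF linear_R linear_alpha] linear_map_comp[OF linear_alpha linear_R]
          linear_map_pre_lie_coproduct linear_map_comp[OF linear_map_cobracket R1] _ _ \<Gamma>l])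
       (simp_all add: R_alpha pre_lie_coproduct_def)
  also have "\<dots> = tensor_map K L L2 L L2 R (tensor_endo R (\<lambda>x. x))
      (tensor_map K L L L L2 \<alpha> cobracket (cobracket l))"
    by (rule tensor_map_comp[OF linear_alpha linear_R linear_map_cobracket R1 \<Gamma>l, symmetric])
  finally show ?thesis
    using tensor_assoc_map[OF linear_R linear_R linear_id
        linear_map.T_im[OF linear_map_tensor_map[OF linear_alpha linear_map_cobracket] \<Gamma>l]]
    by simp
qed

text \<open>
  In \<open>(P \<otimes> \<alpha>) \<circ> P\<close> the operator \<open>R\<close> of the outer \<open>P\<close> is applied before the inner \<open>P\<close>, which is why
  antisymmetrising in the first two factors produces \<open>(1 - \<tau>) \<circ> P \<circ> R\<close>.
\<close>
lemma commutator_coprod_left_pre_lie: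
  assumes w: "w = \<zero>\<^bsub>K\<^esub>" and l: "l \<in> carrier L"
  shows "coprod_left pre_lie_coproduct \<alpha> (pre_lie_coproduct l)
      \<ominus>\<^bsub>L3\<^esub> tau12 (coprod_left pre_lie_coproduct \<alpha> (pre_lie_coproduct l))
    = tensor_map K L2 L L2 L (tensor_endo R R) (\<lambda>z. z) (coprod_left cobracket \<alpha> (cobracket l))"
proof -
  note \<Gamma>l = linear_map.T_im[OF linear_map_cobracket l]
  note RR = linear_map_tensor_map[OF linear_R linear_R]
  note PR = linear_map_comp[OF linear_R linear_map_pre_lie_coproduct]
  note \<tau>PR = linear_map_comp[OF PR linear_map_tau]
  have left: "coprod_left pre_lie_coproduct \<alpha> (pre_lie_coproduct l)
      = coprod_left (\<lambda>x. pre_lie_coproduct (R x)) \<alpha> (cobracket l)"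
    unfolding pre_lie_coproduct_def[of l]
    by (rule tensor_map_comp[OF linear_R linear_map_pre_lie_coproduct linear_id linear_alpha \<Gamma>l])
  have "coprod_left (\<lambda>x. pre_lie_coproduct (R x)) \<alpha> (cobracket l)
        \<ominus>\<^bsub>L3\<^esub> tau12 (coprod_left (\<lambda>x. pre_lie_coproduct (R x)) \<alpha> (cobracket l))
      = coprod_left (\<lambda>x. pre_lie_coproduct (R x) \<ominus>\<^bsub>L2\<^esub> tau (pre_lie_coproduct (R x))) \<alpha> (cobracket l)"
    by (simp only: coprod_left_op[OF PR linear_alpha \<Gamma>l, symmetric]
        tensor_map_minus_left[OF PR \<tau>PR linear_alpha \<Gamma>l])
  also have "\<dots> = coprod_left (\<lambda>x. tensor_endo R R (cobracket x)) \<alpha> (cobracket l)"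
    by (rule tensor_map_cong[OF linear_map_minus[OF PR \<tau>PR] linear_map_comp[OF linear_map_cobracket RR]
          linear_alpha linear_alpha commutator_pre_lie_coproduct_R[OF w] refl \<Gamma>l])
  also have "\<dots> = tensor_map K L2 L L2 L (tensor_endo R R) (\<lambda>z. z) (coprod_left cobracket \<alpha> (cobracket l))"
    by (rule tensor_map_comp[OF linear_map_cobracket RR linear_alpha linear_id \<Gamma>l, symmetric])
  finally show ?thesis
    unfolding left .
qed

lemma tau12_RR:
  assumes t: "t \<in> carrier L3"
  shows "tau12 (tensor_map K L2 L L2 L (tensor_endo R R) (\<lambda>z. z) t)
    = tensor_map K L2 L L2 L (tensor_endo R R) (\<lambda>z. z) (tau12 t)"
proof -
  note RR = linear_map_tensor_map[OF linear_R linear_R]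
  show ?thesis
    unfolding tensor_map_comp[OF RR linear_map_tau linear_id linear_id t]
      tensor_map_comp[OF linear_map_tau RR linear_id linear_id t]
    by (rule tensor_map_cong[OF linear_map_comp[OF RR linear_map_tau] linear_map_comp[OF linear_map_tau RR]
          linear_id linear_id tensor_flip_map[OF linear_R linear_R] refl t])
qed

text \<open>
  With \<open>M = R \<otimes> R \<otimes> 1\<close>, \<open>A = (P \<otimes> \<alpha>) (P l)\<close> and \<open>B = (\<alpha> \<otimes> P) (P l)\<close>, both \<open>A - \<tau>\<^sup>1\<^sup>2 A\<close> and
  \<open>B - \<tau>\<^sup>1\<^sup>2 B\<close> equal \<open>M\<close> applied to \<open>(\<Gamma> \<otimes> \<alpha>) (\<Gamma> l)\<close>: the former by the Rota--Baxter identity,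
  the latter because \<open>M\<close> commutes with \<open>\<tau>\<^sup>1\<^sup>2\<close> and by the co-Jacobi identity.
\<close>
lemma pre_lie_coproduct_hom_pre_lie:
  assumes w: "w = \<zero>\<^bsub>K\<^esub>" and l: "l \<in> carrier L"
  defines "t \<equiv> coprod_left pre_lie_coproduct \<alpha> (pre_lie_coproduct l)
    \<ominus>\<^bsub>L3\<^esub> coprod_right \<alpha> pre_lie_coproduct (pre_lie_coproduct l)"
  shows "t \<ominus>\<^bsub>L3\<^esub> tau12 t = \<zero>\<^bsub>L3\<^esub>"
proof -
  interpret L3: vectorspace K L3 by (rule vectorspace_L3)
  define A where "A = coprod_left pre_lie_coproduct \<alpha> (pre_lie_coproduct l)"
  define B where "B = coprod_right \<alpha> pre_lie_coproduct (pre_lie_coproduct l)"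
  define Y where "Y = coprod_right \<alpha> cobracket (cobracket l)"
  let ?M = "tensor_map K L2 L L2 L (tensor_endo R R) (\<lambda>z. z)"
  note M = linear_map_tensor_map[OF linear_map_tensor_map[OF linear_R linear_R] linear_id]
  note \<Gamma>l = linear_map.T_im[OF linear_map_cobracket l]
  note Pl = linear_map.T_im[OF linear_map_pre_lie_coproduct l]
  have A: "A \<in> carrier L3" and B: "B \<in> carrier L3" and Y: "Y \<in> carrier L3"
    unfolding A_def B_def Y_def
    by (rule coprod_left_closed[OF linear_map_pre_lie_coproduct linear_alpha Pl]
        coprod_right_closed[OF linear_map_pre_lie_coproduct linear_alpha Pl]
        coprod_right_closed[OF linear_map_cobracket linear_alpha \<Gamma>l])+
  note T = linear_map.T_im[OF linear_map_tau12]
  have "B \<ominus>\<^bsub>L3\<^esub> tau12 B = ?M (Y \<ominus>\<^bsub>L3\<^esub> tau12 Y)"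
    unfolding B_def coprod_right_pre_lie[OF l] Y_def[symmetric]
    by (simp only: tau12_RR[OF Y] linear_map.T_minus[OF M Y T[OF Y]])
  also have "\<dots> = A \<ominus>\<^bsub>L3\<^esub> tau12 A"
    unfolding A_def commutator_coprod_left_pre_lie[OF w l] Y_def hom_co_jacobi[OF l] ..
  finally have eq: "A \<ominus>\<^bsub>L3\<^esub> tau12 A = B \<ominus>\<^bsub>L3\<^esub> tau12 B" ..
  have "t \<ominus>\<^bsub>L3\<^esub> tau12 t = (A \<ominus>\<^bsub>L3\<^esub> tau12 A) \<ominus>\<^bsub>L3\<^esub> (B \<ominus>\<^bsub>L3\<^esub> tau12 B)"
    unfolding t_def A_def[symmetric] B_def[symmetric]
    by (simp only: linear_map.T_minus[OF linear_map_tau12 A B])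
       (simp add: A B T L3.minus_minus_swap L3.a_ac)
  then show ?thesis
    using eq A B T by simp
qed

lemma pre_lie_coproduct_coder:
  assumes l: "l \<in> carrier L"
  shows "pre_lie_coproduct (\<phi> l)
    = tensor_endo \<phi> \<alpha> (pre_lie_coproduct l) \<oplus>\<^bsub>L2\<^esub> tensor_endo \<alpha> \<phi> (pre_lie_coproduct l)"
proof -
  note \<Gamma>l = linear_map.T_im[OF linear_map_cobracket l]
  note R1 = linear_map_tensor_map[OF linear_R linear_id]
  have commute: "tensor_endo R (\<lambda>x. x) (tensor_endo f g (cobracket l)) = tensor_endo f g (tensor_endo R (\<lambda>x. x) (cobracket l))"
    if f: "linear_map K L L f" and g: "linear_map K L L g" and fR: "\<And>x. x \<in> carrier L \<Longrightarrow> R (f x) = f (R x)" for f g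
    unfolding tensor_map_comp[OF f linear_R g linear_id \<Gamma>l] tensor_map_comp[OF linear_R f linear_id g \<Gamma>l]
    by (rule tensor_map_cong[OF linear_map_comp[OF f linear_R] linear_map_comp[OF linear_R f] g g fR refl \<Gamma>l])
  show ?thesis
    unfolding pre_lie_coproduct_def cobracket_coder[OF l]
    by (simp only: linear_map.T_add[OF R1] \<Gamma>l linear_map.T_im[OF linear_map_tensor_map[OF linear_phi linear_alpha]]
        linear_map.T_im[OF linear_map_tensor_map[OF linear_alpha linear_phi]]
        commute[OF linear_phi linear_alpha phi_R[symmetric]] commute[OF linear_alpha linear_phi R_alpha])
qed

end

theorem theorem4p4:
  fixes K :: "('k, 'q) ring_scheme" and L :: "('k, 'a, 'm) module_scheme"
    and \<Delta> :: "'a \<Rightarrow> ('a \<times> 'a \<Rightarrow> 'k) set" and \<phi> \<alpha> R :: "'a \<Rightarrow> 'a"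
  assumes "rota_baxter_hom_coass_coder_pair K L \<Delta> \<phi> \<alpha> R \<zero>\<^bsub>K\<^esub>"
  shows "hom_pre_lie_coder_pair K L
    (\<lambda>l. tensor_map K L L L L R (\<lambda>x. x) (\<Delta> l)
       \<ominus>\<^bsub>tensor K L L\<^esub> tensor_flip K L L (tensor_map K L L L L (\<lambda>x. x) R (\<Delta> l)))
    \<phi> \<alpha>"
proof -
  interpret rota_baxter_hom_coass_coder_pair K L \<Delta> \<phi> \<alpha> R "\<zero>\<^bsub>K\<^esub>" by fact
  let ?D = "\<lambda>l. tensor_endo R (\<lambda>x. x) (\<Delta> l) \<ominus>\<^bsub>L2\<^esub> tau (tensor_endo (\<lambda>x. x) R (\<Delta> l))"
  note P = linear_map_pre_lie_coproduct
  note Pl = linear_map.T_im[OF P]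
  have D: "linear_map K L L2 ?D"
    using P pre_lie_coproduct_eq by (rule linear_map_cong)
  have left: "coprod_left ?D \<alpha> t = coprod_left pre_lie_coproduct \<alpha> t" if "t \<in> carrier L2" for t
    by (rule tensor_map_cong[OF D P linear_alpha linear_alpha pre_lie_coproduct_eq refl that])
  have right: "coprod_right \<alpha> ?D t = coprod_right \<alpha> pre_lie_coproduct t" if "t \<in> carrier L2" for t
    by (rule arg_cong[OF tensor_map_cong[OF linear_alpha linear_alpha D P refl pre_lie_coproduct_eq that]])
  show ?thesis
  proof (intro hom_pre_lie_coder_pair.intro hom_pre_lie_coder_pair_axioms.intro vectorspace_char_0_axioms
      D linear_phi linear_alpha)
    fix l assume l: "l \<in> carrier L"
    show "(let t = coprod_left ?D \<alpha> (?D l) \<ominus>\<^bsub>L3\<^esub> coprod_right \<alpha> ?D (?D l) in t \<ominus>\<^bsub>L3\<^esub> tau12 t) = \<zero>\<^bsub>L3\<^esub>"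
      unfolding Let_def pre_lie_coproduct_eq[OF l] left[OF Pl[OF l]] right[OF Pl[OF l]]
      by (rule pre_lie_coproduct_hom_pre_lie[OF refl l])
    show "?D (\<phi> l) = tensor_endo \<phi> \<alpha> (?D l) \<oplus>\<^bsub>L2\<^esub> tensor_endo \<alpha> \<phi> (?D l)"
      unfolding pre_lie_coproduct_eq[OF l] pre_lie_coproduct_eq[OF linear_map.T_im[OF linear_phi l]]
      by (rule pre_lie_coproduct_coder[OF l])
  qed
qed

end
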